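(* Let $n\geq 2$ be an even integer, let $p$ be a prime and let $r$ be a positive integer. If $p$ is odd and $r>\log_p\frac n2+1$, then $$S_n(p^r)=\binom{n-1}{\frac n2-1}\,\frac{p-1}{p}\,p^{(\frac n2+1)r}.$$ If $p=2$ and $r>\log_2 n+2$, then $$S_n(2^r)=\binom{n-1}{\frac n2-1}\,2^{\frac n2-2}\,2^{(\frac n2+1)r}.$$
   Context: For an integer $q\ge 3$, let $\zeta=e^{2\pi i/q}$. For integers $u,v$ the Kloosterman sum is $$K(u,v;q)=\sum_{\substack{0<x\le q\\ (x,q)=1}}\zeta^{ux+v\bar x},$$ where $\bar x$ denotes the multiplicative inverse of $x$ in $(\mathbb{Z}/q\mathbb{Z})^*$. For a positive integer $n$, the $n$-th power moment is $$S_n(q)=\sum_{u=1}^q K(u,1;q)^n.$$ Here $\log_p$ is the real logarithm to base $p$. *)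

theory Defs
  imports "HOL-Analysis.Analysis" "HOL-Number_Theory.Number_Theory"
begin

definition zeta_root :: "nat \<Rightarrow> complex" where
  "zeta_root q = exp (2 * of_real pi * \<i> / of_nat q)"

text \<open>
  Exponents are integers of either sign, hence \<open>powi\<close>. The summand depends only on the residue
  class of the inverse, because \<^term>\<open>zeta_root q\<close> is a \<open>q\<close>-th root of unity for positive \<open>q\<close>.
\<close>
definition kloosterman_sum :: "int \<Rightarrow> int \<Rightarrow> nat \<Rightarrow> complex" where
  "kloosterman_sum u v q =
     (\<Sum>x | 0 < x \<and> x \<le> int q \<and> coprime x (int q).
        zeta_root q powi (u * x + v * modular_inverse (int q) x))"

definition kloosterman_moment :: "nat \<Rightarrow> nat \<Rightarrow> complex" where
  "kloosterman_moment n q = (\<Sum>u = 1..int q. kloosterman_sum u 1 q ^ n)"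

end

theory Submission
  imports Defs
begin

text \<open>
  Write \<open>q = p ^ r\<close>, \<open>e(k) = zeta_root q powi k\<close>, \<open>h = n div 2\<close> and \<open>y'\<close> for the inverse of \<open>y\<close>
  modulo \<open>q\<close>. Replacing \<open>x\<close> by \<open>c' y\<close> turns \<open>K(u c\<^sup>2, 1; q)\<close> into the sum of \<open>e(c (u y + y'))\<close>
  over the units \<open>y\<close>. The phase \<open>u y + y'\<close> is odd in \<open>y\<close>, and by stationary phase (averaging over
  \<open>y \<mapsto> y (1 + d t)\<close> with \<open>d\<close> a suitable power of \<open>p\<close>) only the \<open>y\<close> close to \<open>1\<close> or to \<open>-1\<close>
  contribute, if the unit \<open>u\<close> is well chosen. Hence \<open>K(u c\<^sup>2, 1; q) = A(c) + cnj (A(c))\<close>, where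
  \<open>A(c)\<close> is a phase factor times a short quadratic Gauss sum: this is lemma
  \<open>kloosterman_sum_localized\<close>. Two properties of \<open>A\<close> matter. Its modulus \<open>\<bar>A(c)\<bar>\<^sup>2 = N\<close> does not
  depend on \<open>c\<close>, and \<open>A(c + p)\<^sup>2 = \<omega> A(c)\<^sup>2\<close> for a root of unity \<open>\<omega>\<close> whose order is a power of
  \<open>p\<close>, greater than \<open>h\<close> under the size condition on \<open>r\<close>.

  Expand \<open>(A(c) + cnj (A(c))) ^ n\<close> by the binomial theorem and sum over the units \<open>c\<close>. An
  unbalanced term is a constant times the sum of \<open>A(c) ^ (2 j)\<close> with \<open>0 < j \<le> h\<close>, or the conjugate
  of such a sum; translating \<open>c\<close> by \<open>p\<close> multiplies it by \<open>\<omega> ^ j \<noteq> 1\<close>, so it is zero. What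
  remains is the middle term, \<open>(n choose h) N ^ h \<phi>(q)\<close>.

  It remains to return from \<open>c\<close> to the argument \<open>u c\<^sup>2\<close>. Each fibre of \<open>c \<mapsto> u c\<^sup>2\<close> has at most
  \<open>F\<close> elements, with \<open>F = 2\<close> for odd \<open>p\<close> and \<open>F = 4\<close> for \<open>p = 2\<close>. One has to know that the
  bound is attained wherever the Kloosterman sum is nonzero, and in particular that the sums outside
  the image vanish. This comes out of the second moments: orthogonality gives
  \<open>S_2(q) = q \<phi>(q)\<close>, and since \<open>2 N = F q\<close> the sum of the squares over \<open>c\<close> equals \<open>F S_2(q)\<close>. As Kloosterman sums are real, no slack is left: every \<open>v\<close> with \<open>K(v, 1; q) \<noteq> 0\<close> has
  a fibre of exactly \<open>F\<close> elements. Thus \<open>F S_n(q)\<close> is the sum computed above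
  (lemma \<open>kloosterman_moment_of_covariant_splitting\<close>).

  The constants are \<open>u = 1\<close>, \<open>N = q\<close> for odd \<open>p\<close>, and \<open>N = 2 q\<close> for \<open>p = 2\<close>, \<open>r \<ge> 5\<close>, where
  \<open>u = 1\<close> for even \<open>r\<close> and \<open>u = 1 + 2 ^ s\<close> for \<open>r = 2 s + 1\<close>. For \<open>p = 2\<close>, \<open>r = 4\<close> the hypothesis
  leaves only \<open>n = 2\<close>, which is the second moment.
\<close>

section \<open>Additive characters and sums over residues\<close>

definition add_char :: "nat \<Rightarrow> int \<Rightarrow> complex" where
  "add_char q k = zeta_root q powi k"

lemma zeta_root_nonzero: "zeta_root q \<noteq> 0"
  by (simp add: zeta_root_def)

lemma add_char_0 [simp]: "add_char q 0 = 1"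
  by (simp add: add_char_def)

lemma add_char_add: "add_char q (a + b) = add_char q a * add_char q b"
  by (simp add: add_char_def power_int_add zeta_root_nonzero)

lemma add_char_power: "add_char q a ^ j = add_char q (a * int j)"
  by (simp add: add_char_def power_int_mult)

lemma norm_add_char [simp]: "norm (add_char q a) = 1"
  by (simp add: add_char_def zeta_root_def norm_power_int norm_exp_eq_Re)

lemma cnj_add_char: "cnj (add_char q a) = add_char q (- a)"
proof -
  have "add_char q a * add_char q (- a) = 1"
    by (metis add_char_add add_char_0 add.right_inverse)
  moreover have "add_char q a * cnj (add_char q a) = 1"
    by (simp add: complex_norm_square[symmetric])
  ultimately show ?thesis
    by (metis mult_cancel_left mult_zero_left zero_neq_one)
qed

lemma add_char_eq_1_iff:
  assumes "q > 0"
  shows "add_char q k = 1 \<longleftrightarrow> int q dvd k"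
proof -
  have "add_char q k = exp (of_int k * (2 * of_real pi * \<i> / of_nat q))"
    by (simp add: add_char_def zeta_root_def exp_power_int)
  also have "\<dots> = 1 \<longleftrightarrow> (\<exists>m::int. of_int k * (2 * pi) / real q = of_int (2 * m) * pi)"
    by (simp add: exp_eq_1)
  also have "\<dots> \<longleftrightarrow> (\<exists>m::int. real_of_int k = of_int (m * int q))"
    by (rule arg_cong[where f = Ex], rule ext) (use assms in \<open>simp add: field_simps\<close>)
  also have "\<dots> \<longleftrightarrow> int q dvd k"
    unfolding of_int_eq_iff by (auto simp: dvd_def mult.commute)
  finally show ?thesis .
qed

lemma add_char_cong:
  assumes "q > 0" "[a = b] (mod int q)"
  shows "add_char q a = add_char q b"
proof -
  have "int q dvd a - b"
    using assms(2) by (simp add: cong_iff_dvd_diff)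
  hence "add_char q (b + (a - b)) = add_char q b"
    using assms(1) add_char_eq_1_iff unfolding add_char_add by simp
  thus ?thesis by simp
qed

text \<open>
  A map that is injective on residue classes and preserves a finite set of representatives
  permutes it. All changes of variable below (translations, dilations, \<open>y \<mapsto> y (1 + h t)\<close>) are
  instances.
\<close>
lemma sum_reindex_mod:
  fixes M :: int and g :: "int \<Rightarrow> complex"
  assumes "S \<subseteq> {0..<M}"
    and closed: "\<And>x. x \<in> S \<Longrightarrow> \<sigma> x mod M \<in> S"
    and inj: "\<And>x y. x \<in> S \<Longrightarrow> y \<in> S \<Longrightarrow> [\<sigma> x = \<sigma> y] (mod M) \<Longrightarrow> [x = y] (mod M)"
    and periodic: "\<And>x y. [x = y] (mod M) \<Longrightarrow> g x = g y"
  shows "(\<Sum>x\<in>S. g (\<sigma> x)) = (\<Sum>x\<in>S. g x)"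
proof -
  have fin: "finite S"
    using assms(1) finite_subset by blast
  have "inj_on (\<lambda>x. \<sigma> x mod M) S"
  proof (rule inj_onI)
    fix x y assume xy: "x \<in> S" "y \<in> S" "\<sigma> x mod M = \<sigma> y mod M"
    have "[x = y] (mod M)"
      by (rule inj[OF xy(1,2)]) (use xy(3) in \<open>simp add: cong_def\<close>)
    moreover have "x \<in> {0..<M}" "y \<in> {0..<M}"
      using xy assms(1) by auto
    ultimately show "x = y"
      by (simp add: cong_def)
  qed
  moreover have "(\<lambda>x. \<sigma> x mod M) ` S \<subseteq> S"
    using closed by blast
  ultimately have "bij_betw (\<lambda>x. \<sigma> x mod M) S S"
    using fin by (simp add: bij_betw_def endo_inj_surj)
  hence "(\<Sum>x\<in>S. g (\<sigma> x mod M)) = (\<Sum>x\<in>S. g x)"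
    by (rule sum.reindex_bij_betw)
  moreover have "g (\<sigma> x mod M) = g (\<sigma> x)" for x
    by (rule periodic) (simp add: cong_def)
  ultimately show ?thesis by simp
qed

lemma sum_shift_mod:
  fixes M :: int and g :: "int \<Rightarrow> complex"
  assumes "\<And>x y. [x = y] (mod M) \<Longrightarrow> g x = g y"
  shows "(\<Sum>x\<in>{0..<M}. g (x + b)) = (\<Sum>x\<in>{0..<M}. g x)"
  by (rule sum_reindex_mod[where \<sigma> = "\<lambda>x. x + b" and M = M])
     (use assms in \<open>auto simp: cong_add_rcancel\<close>)

text \<open>
  Translation by \<open>1\<close> multiplies the sum by \<open>add_char q k\<close>, so it is zero unless this factor is
  \<open>1\<close>. The length \<open>M\<close> may be a proper divisor of \<open>q\<close>, as long as \<open>t \<mapsto> add_char q (k * t)\<close> has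
  period \<open>M\<close>; this is the form that stationary phase needs.
\<close>
lemma add_char_orthogonality:
  fixes M :: int
  assumes "q > 0" "M \<ge> 0" "int q dvd k * M"
  shows "(\<Sum>t\<in>{0..<M}. add_char q (k * t)) = (if int q dvd k then of_int M else 0)"
proof (cases "int q dvd k")
  case True
  have "add_char q (k * t) = 1" for t
    using True assms(1) by (simp add: add_char_eq_1_iff)
  thus ?thesis using True assms(2) by simp
next
  case False
  let ?S = "\<Sum>t\<in>{0..<M}. add_char q (k * t)"
  have per: "add_char q (k * x) = add_char q (k * y)" if "[x = y] (mod M)" for x y
  proof (rule add_char_cong[OF assms(1)])
    have "k * M dvd k * x - k * y"
      using that by (metis cong_iff_dvd_diff mult_dvd_mono dvd_refl right_diff_distrib)
    thus "[k * x = k * y] (mod int q)"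
      using assms(3) by (metis cong_iff_dvd_diff dvd_trans)
  qed
  have "?S = (\<Sum>t\<in>{0..<M}. add_char q (k * (t + 1)))"
    by (rule sum_shift_mod[symmetric]) (use per in auto)
  also have "\<dots> = add_char q k * ?S"
    by (simp add: distrib_left add_char_add sum_distrib_left mult.commute)
  finally have "(1 - add_char q k) * ?S = 0"
    by (simp add: algebra_simps)
  thus ?thesis
    using False assms(1) by (simp add: add_char_eq_1_iff[symmetric])
qed

section \<open>Reality and second moment of Kloosterman sums\<close>

definition units_mod :: "nat \<Rightarrow> int set" where
  "units_mod q = {x. 0 < x \<and> x \<le> int q \<and> coprime x (int q)}"

lemma units_mod_eq:
  assumes "q > 1"
  shows "units_mod q = {x\<in>{0..<int q}. coprime x (int q)}"
proof (rule Set.set_eqI)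
  fix x
  have "coprime x (int q) \<Longrightarrow> x \<noteq> 0 \<and> x \<noteq> int q"
    using assms by auto
  thus "x \<in> units_mod q \<longleftrightarrow> x \<in> {x\<in>{0..<int q}. coprime x (int q)}"
    by (auto simp: units_mod_def)
qed

lemma finite_units_mod [simp]: "finite (units_mod q)"
  by (rule finite_subset[of _ "{0..int q}"]) (auto simp: units_mod_def)

lemma coprime_mod_cong:
  assumes "[x = y] (mod m)" shows "coprime x (m::int) \<longleftrightarrow> coprime y m"
  using assms by (metis cong_imp_coprime cong_sym)

lemma mod_in_units_mod:
  assumes "q > 1" "coprime x (int q)"
  shows "x mod int q \<in> units_mod q"
  using assms coprime_mod_cong[of "x mod int q" x "int q"]
  by (simp add: units_mod_eq cong_def)

lemma card_units_mod: "card (units_mod q) = totient q"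
proof -
  have "units_mod q = int ` totatives q"
  proof (rule Set.set_eqI)
    fix x :: int
    show "x \<in> units_mod q \<longleftrightarrow> x \<in> int ` totatives q"
    proof (cases "x \<ge> 0")
      case True
      then obtain n where "x = int n" by (metis nonneg_eq_int)
      thus ?thesis by (auto simp: units_mod_def totatives_def)
    next
      case False
      thus ?thesis by (auto simp: units_mod_def)
    qed
  qed
  thus ?thesis by (simp add: card_image totient_def)
qed

lemma sum_units_mult:
  fixes g :: "int \<Rightarrow> complex"
  assumes "q > 1" "coprime a (int q)"
    and per: "\<And>x y. [x = y] (mod int q) \<Longrightarrow> g x = g y"
  shows "(\<Sum>x\<in>units_mod q. g (a * x)) = (\<Sum>x\<in>units_mod q. g x)"
proof (rule sum_reindex_mod[where M = "int q"])
  show "units_mod q \<subseteq> {0..<int q}" using assms(1) by (auto simp: units_mod_eq)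
  show "a * x mod int q \<in> units_mod q" if "x \<in> units_mod q" for x
    by (rule mod_in_units_mod) (use that assms in \<open>auto simp: units_mod_def\<close>)
  show "[x = y] (mod int q)" if "[a * x = a * y] (mod int q)" for x y
    using that assms(2) by (simp add: cong_mult_lcancel)
qed (use per in auto)

lemma kloosterman_sum_alt:
  "kloosterman_sum u v q
     = (\<Sum>x\<in>units_mod q. add_char q (u * x + v * modular_inverse (int q) x))"
  by (simp add: kloosterman_sum_def units_mod_def add_char_def)

lemma modular_inverse_cong:
  fixes x y m :: int
  assumes "[x = y] (mod m)"
  shows "[modular_inverse m x = modular_inverse m y] (mod m)"
proof (cases "coprime x m")
  case True
  hence y: "coprime y m" using assms coprime_mod_cong by blast
  let ?a = "modular_inverse m x" and ?b = "modular_inverse m y"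
  have "[?a * 1 = ?a * (y * ?b)] (mod m)"
    by (intro cong_mult cong_refl cong_sym[OF cong_modular_inverse1[OF y]])
  also have "[?a * (y * ?b) = ?a * (x * ?b)] (mod m)"
    by (intro cong_mult cong_refl cong_sym[OF assms])
  also have "?a * (x * ?b) = (x * ?a) * ?b" by simp
  also have "[(x * ?a) * ?b = 1 * ?b] (mod m)"
    by (intro cong_mult cong_refl cong_modular_inverse1[OF True])
  finally show ?thesis by simp
next
  case False
  hence "\<not> coprime y m" using assms coprime_mod_cong by blast
  thus ?thesis using False by (simp add: modular_inverse_def coprime_commute)
qed

lemma cong_modular_inverseI:
  fixes x y m :: int
  assumes "[x * y = 1] (mod m)"
  shows "[modular_inverse m x = y] (mod m)"
proof -
  have x: "coprime x m"
    using assms by (metis coprime_iff_invertible_int)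
  have "[modular_inverse m x * (x * y) = modular_inverse m x * 1] (mod m)"
    by (intro cong_mult cong_refl assms)
  moreover have "[(modular_inverse m x * x) * y = 1 * y] (mod m)"
    by (intro cong_mult cong_refl cong_modular_inverse2[OF x])
  ultimately show ?thesis
    by (metis cong_sym cong_trans mult.assoc mult.right_neutral mult_1)
qed

lemma modular_inverse_minus_cong:
  fixes x m :: int
  assumes "coprime x m"
  shows "[modular_inverse m (- x) = - modular_inverse m x] (mod m)"
  by (rule cong_modular_inverseI) (use cong_modular_inverse1[OF assms] in simp)

lemma kloosterman_sum_cong:
  assumes "q > 0" "[u = u'] (mod int q)"
  shows "kloosterman_sum u v q = kloosterman_sum u' v q"
  unfolding kloosterman_sum_alt
  by (intro sum.cong refl add_char_cong[OF assms(1)] cong_add cong_mult assms(2) cong_refl)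

text \<open>
  Conjugation replaces the summation variable \<open>x\<close> by \<open>- x\<close>. Reality makes the squares of the sums
  nonnegative, on which the comparison of second moments rests.
\<close>
lemma kloosterman_sum_real:
  assumes "q > 1"
  shows "cnj (kloosterman_sum u v q) = kloosterman_sum u v q"
proof -
  let ?g = "\<lambda>x. add_char q (u * x + v * modular_inverse (int q) x)"
  have "cnj (kloosterman_sum u v q) = (\<Sum>x\<in>units_mod q. ?g (-1 * x))"
    unfolding kloosterman_sum_alt cnj_sum cnj_add_char
  proof (intro sum.cong refl add_char_cong)
    fix x assume "x \<in> units_mod q"
    hence "coprime x (int q)" by (simp add: units_mod_def)
    hence "[v * modular_inverse (int q) (- x) = v * - modular_inverse (int q) x] (mod int q)"
      by (intro cong_mult cong_refl modular_inverse_minus_cong)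
    hence "[u * (-x) + v * modular_inverse (int q) (- x)
             = u * (-x) + v * - modular_inverse (int q) x] (mod int q)"
      by (intro cong_add cong_refl)
    thus "[- (u * x + v * modular_inverse (int q) x)
             = u * (- 1 * x) + v * modular_inverse (int q) (- 1 * x)] (mod int q)"
      by (simp add: cong_sym)
  qed (use assms in auto)
  also have "\<dots> = (\<Sum>x\<in>units_mod q. ?g x)"
    by (rule sum_units_mult)
       (use assms in \<open>auto intro!: add_char_cong cong_add cong_mult modular_inverse_cong\<close>)
  finally show ?thesis by (simp add: kloosterman_sum_alt)
qed

lemma kloosterman_moment_alt:
  assumes "q > 0"
  shows "kloosterman_moment n q = (\<Sum>u\<in>{0..<int q}. kloosterman_sum u 1 q ^ n)"
proof -
  have "(\<Sum>u\<in>{0..<int q}. kloosterman_sum u 1 q ^ n)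
          = (\<Sum>u\<in>{0..<int q}. kloosterman_sum (u + 1) 1 q ^ n)"
    by (rule sum_shift_mod[symmetric]) (use kloosterman_sum_cong assms in metis)
  also have "\<dots> = (\<Sum>u\<in>{1..int q}. kloosterman_sum u 1 q ^ n)"
    by (rule sum.reindex_bij_witness[of _ "\<lambda>u. u - 1" "\<lambda>u. u + 1"]) auto
  finally show ?thesis by (simp add: kloosterman_moment_def)
qed

text \<open>
  By reality the square is \<open>K * cnj K\<close>; in the resulting double sum over units \<open>x, y\<close>,
  orthogonality in \<open>u\<close> leaves the diagonal \<open>x = y\<close>, where the summand is \<open>1\<close>.
\<close>
lemma kloosterman_second_moment:
  assumes "q > 1"
  shows "kloosterman_moment 2 q = of_nat (q * totient q)"
proof -
  let ?inv = "modular_inverse (int q)"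
  have "kloosterman_sum u 1 q ^ 2
     = (\<Sum>x\<in>units_mod q. \<Sum>y\<in>units_mod q. add_char q (?inv x - ?inv y) * add_char q ((x - y) * u))"
    for u
  proof -
    have "kloosterman_sum u 1 q ^ 2 = kloosterman_sum u 1 q * cnj (kloosterman_sum u 1 q)"
      using kloosterman_sum_real[OF assms] by (simp add: power2_eq_square)
    also have "\<dots> = (\<Sum>x\<in>units_mod q. \<Sum>y\<in>units_mod q.
        add_char q (u * x + 1 * ?inv x) * add_char q (- (u * y + 1 * ?inv y)))"
      by (simp only: kloosterman_sum_alt cnj_sum cnj_add_char sum_product)
    also have "\<dots> = (\<Sum>x\<in>units_mod q. \<Sum>y\<in>units_mod q.
        add_char q (?inv x - ?inv y) * add_char q ((x - y) * u))"
      by (intro sum.cong refl, unfold add_char_add[symmetric])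
         (simp add: algebra_simps)
    finally show ?thesis .
  qed
  hence "kloosterman_moment 2 q = (\<Sum>u\<in>{0..<int q}. \<Sum>x\<in>units_mod q. \<Sum>y\<in>units_mod q.
           add_char q (?inv x - ?inv y) * add_char q ((x - y) * u))"
    using assms by (simp add: kloosterman_moment_alt)
  also have "\<dots> = (\<Sum>x\<in>units_mod q. \<Sum>u\<in>{0..<int q}. \<Sum>y\<in>units_mod q.
           add_char q (?inv x - ?inv y) * add_char q ((x - y) * u))"
    by (rule sum.swap)
  also have "\<dots> = (\<Sum>x\<in>units_mod q. \<Sum>y\<in>units_mod q. \<Sum>u\<in>{0..<int q}.
           add_char q (?inv x - ?inv y) * add_char q ((x - y) * u))"
    by (intro sum.cong refl sum.swap)
  also have "\<dots> = (\<Sum>x\<in>units_mod q. \<Sum>y\<in>units_mod q. if x = y then of_nat q else 0)"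
  proof (intro sum.cong refl)
    fix x y assume "x \<in> units_mod q" "y \<in> units_mod q"
    hence "int q dvd x - y \<longleftrightarrow> x = y"
      using assms by (auto simp: units_mod_eq cong_iff_dvd_diff[symmetric] cong_def)
    moreover have "(\<Sum>u\<in>{0..<int q}. add_char q ((x - y) * u))
                     = (if int q dvd x - y then of_int (int q) else 0)"
      by (rule add_char_orthogonality) (use assms in auto)
    ultimately show "(\<Sum>u\<in>{0..<int q}. add_char q (?inv x - ?inv y) * add_char q ((x - y) * u))
                       = (if x = y then of_nat q else 0)"
      by (simp add: sum_distrib_left[symmetric])
  qed
  also have "\<dots> = of_nat (q * totient q)"
    by (simp add: card_units_mod mult.commute)
  finally show ?thesis .
qed


section \<open>Moments from a covariant splitting\<close>

lemma coprime_prime_power_iff: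
  assumes "prime p" "r > 0"
  shows "coprime x (int (p ^ r)) \<longleftrightarrow> \<not> int p dvd x"
proof -
  have "coprime x (int (p ^ r)) \<longleftrightarrow> coprime x (int p)"
    using assms(2) by simp
  also have "\<dots> \<longleftrightarrow> \<not> int p dvd x"
  proof
    assume cop: "coprime x (int p)"
    show "\<not> int p dvd x"
    proof
      assume "int p dvd x"
      hence "is_unit (int p)"
        using coprime_common_divisor[OF cop, of "int p"] by simp
      thus False
        using assms(1) by simp
    qed
  next
    assume "\<not> int p dvd x"
    thus "coprime x (int p)"
      using assms(1) prime_imp_coprime[of "int p" x] by (simp add: coprime_commute)
  qed
  finally show ?thesis .
qed

lemma sum_units_shift:
  fixes g :: "int \<Rightarrow> complex"
  assumes "prime p" "r > 0" "q = p ^ r"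
    and per: "\<And>x y. [x = y] (mod int q) \<Longrightarrow> g x = g y"
  shows "(\<Sum>x\<in>units_mod q. g (x + int p)) = (\<Sum>x\<in>units_mod q. g x)"
proof -
  have q: "q > 1"
    using assms(1-3) prime_gt_1_nat one_less_power by blast
  show ?thesis
  proof (rule sum_reindex_mod[where M = "int q"])
    show "units_mod q \<subseteq> {0..<int q}" using q by (auto simp: units_mod_eq)
    show "(x + int p) mod int q \<in> units_mod q" if "x \<in> units_mod q" for x
    proof (rule mod_in_units_mod[OF q])
      have "coprime x (int q)" using that by (simp add: units_mod_def)
      thus "coprime (x + int p) (int q)"
        unfolding assms(3) coprime_prime_power_iff[OF assms(1,2)] by simp
    qed
    show "[x = y] (mod int q)" if "[x + int p = y + int p] (mod int q)" for x y
      using that by (simp add: cong_add_rcancel)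
  qed (use per in auto)
qed

text \<open>
  In the binomial expansion a term with unequal exponents reduces, using \<open>\<bar>A c\<bar>\<^sup>2 = N\<close>, to a sum
  of \<open>A c ^ (2 * j)\<close> or its conjugate. The translation \<open>c \<mapsto> c + p\<close>, which preserves the units
  modulo a power of \<open>p\<close>, multiplies this sum by \<open>\<omega> ^ j \<noteq> 1\<close>. Only the middle term survives.
\<close>
lemma sum_units_power_real_part:
  fixes A :: "int \<Rightarrow> complex" and N :: real
  assumes "prime p" "r > 0" "q = p ^ r"
    and per: "\<And>c d. [c = d] (mod int q) \<Longrightarrow> A c = A d"
    and norm: "\<And>c. coprime c (int q) \<Longrightarrow> (cmod (A c))\<^sup>2 = N"
    and cov: "\<And>c. coprime c (int q) \<Longrightarrow> A (c + int p) ^ 2 = \<omega> * A c ^ 2"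
    and omega: "\<And>j. 0 < j \<Longrightarrow> j \<le> h \<Longrightarrow> \<omega> ^ j \<noteq> 1"
    and "m \<le> h"
  shows "(\<Sum>c\<in>units_mod q. (A c + cnj (A c)) ^ (2 * m))
           = of_nat (((2 * m) choose m) * totient q) * of_real N ^ m"
proof -
  have cop: "coprime c (int q)" if "c \<in> units_mod q" for c
    using that by (simp add: units_mod_def)
  have AN: "A c * cnj (A c) = of_real N" if "c \<in> units_mod q" for c
    using norm[OF cop[OF that]] by (simp add: complex_norm_square[symmetric])
  have even_power: "(\<Sum>c\<in>units_mod q. A c ^ (2 * j)) = 0" if "0 < j" "j \<le> h" for j
  proof -
    let ?S = "\<Sum>c\<in>units_mod q. A c ^ (2 * j)"
    have "?S = (\<Sum>c\<in>units_mod q. A (c + int p) ^ (2 * j))"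
      by (rule sum_units_shift[symmetric]) (use assms(1-3) per in auto)
    also have "\<dots> = \<omega> ^ j * ?S"
      unfolding sum_distrib_left power_mult
      by (intro sum.cong refl) (simp add: cov cop power_mult_distrib)
    finally have "(1 - \<omega> ^ j) * ?S = 0" by (simp add: algebra_simps)
    thus ?thesis using omega[OF that] by simp
  qed
  have unbalanced: "(\<Sum>c\<in>units_mod q. A c ^ (b + 2 * j) * cnj (A c) ^ b) = 0"
    if "0 < j" "j \<le> h" for b j
  proof -
    have "(\<Sum>c\<in>units_mod q. A c ^ (b + 2 * j) * cnj (A c) ^ b)
            = (\<Sum>c\<in>units_mod q. of_real N ^ b * A c ^ (2 * j))"
      by (intro sum.cong refl)
         (simp add: AN[symmetric] power_add power_mult_distrib mult_ac)
    thus ?thesis using even_power[OF that] by (simp add: sum_distrib_left[symmetric])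
  qed
  have mixed: "(\<Sum>c\<in>units_mod q. A c ^ k * cnj (A c) ^ (2 * m - k))
                 = (if k = m then of_nat (totient q) * of_real N ^ m else 0)"
    if "k \<le> 2 * m" for k
  proof (rule linorder_cases[of k m])
    assume "k = m"
    have "(\<Sum>c\<in>units_mod q. A c ^ m * cnj (A c) ^ m) = (\<Sum>c\<in>units_mod q. of_real N ^ m)"
      by (intro sum.cong refl) (simp add: AN power_mult_distrib[symmetric])
    thus ?thesis using \<open>k = m\<close> by (simp add: card_units_mod mult_2)
  next
    assume "k > m"
    have "(\<Sum>c\<in>units_mod q. A c ^ ((2 * m - k) + 2 * (k - m)) * cnj (A c) ^ (2 * m - k)) = 0"
      by (rule unbalanced) (use \<open>k > m\<close> that \<open>m \<le> h\<close> in auto)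
    moreover have "(2 * m - k) + 2 * (k - m) = k"
      using \<open>k > m\<close> that by simp
    ultimately show ?thesis using \<open>k > m\<close> by simp
  next
    assume "k < m"
    have "cnj (\<Sum>c\<in>units_mod q. A c ^ (k + 2 * (m - k)) * cnj (A c) ^ k) = 0"
      by (subst unbalanced) (use \<open>k < m\<close> that \<open>m \<le> h\<close> in auto)
    moreover have "k + 2 * (m - k) = 2 * m - k"
      using \<open>k < m\<close> that by simp
    ultimately show ?thesis using \<open>k < m\<close> by (simp add: mult.commute)
  qed
  have "(\<Sum>c\<in>units_mod q. (A c + cnj (A c)) ^ (2 * m))
          = (\<Sum>c\<in>units_mod q. \<Sum>k\<le>2 * m. of_nat ((2 * m) choose k) *
               (A c ^ k * cnj (A c) ^ (2 * m - k)))"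
    by (simp add: binomial_ring mult.assoc)
  also have "\<dots> = (\<Sum>k\<le>2 * m. of_nat ((2 * m) choose k) *
               (\<Sum>c\<in>units_mod q. A c ^ k * cnj (A c) ^ (2 * m - k)))"
    unfolding sum_distrib_left by (rule sum.swap)
  also have "\<dots> = (\<Sum>k\<le>2 * m. if k = m then of_nat (((2 * m) choose m) * totient q) * of_real N ^ m
                                          else 0)"
    by (intro sum.cong refl) (auto simp: mixed)
  also have "\<dots> = of_nat (((2 * m) choose m) * totient q) * of_real N ^ m"
    by simp
  finally show ?thesis .
qed

text \<open>
  The hypothesis \<open>2 * N = F * q\<close> says that the second moment over the parameter \<open>c\<close> is as large
  as the fibre bound permits. Hence a nonzero Kloosterman sum \<open>K(v, 1; q)\<close> forces
  \<open>v\<close> to be of the form \<open>u\<^sub>0 * c\<^sup>2\<close> with exactly \<open>F\<close> solutions \<open>c\<close>, and the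
  moment of order \<open>2 * h\<close> over all arguments is \<open>1 / F\<close> times the one over the parameter.
\<close>
lemma kloosterman_moment_of_covariant_splitting:
  fixes A :: "int \<Rightarrow> complex" and N :: real and F :: nat
  assumes "prime p" "r > 0" "q = p ^ r" "h \<ge> 1"
    and split: "\<And>c. coprime c (int q) \<Longrightarrow> kloosterman_sum (u\<^sub>0 * c\<^sup>2) 1 q = A c + cnj (A c)"
    and per: "\<And>c d. [c = d] (mod int q) \<Longrightarrow> A c = A d"
    and norm: "\<And>c. coprime c (int q) \<Longrightarrow> (cmod (A c))\<^sup>2 = N"
    and cov: "\<And>c. coprime c (int q) \<Longrightarrow> A (c + int p) ^ 2 = \<omega> * A c ^ 2"
    and omega: "\<And>j. 0 < j \<Longrightarrow> j \<le> h \<Longrightarrow> \<omega> ^ j \<noteq> 1"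
    and fibre: "\<And>v. card {c \<in> units_mod q. [u\<^sub>0 * c\<^sup>2 = v] (mod int q)} \<le> F"
    and NF: "2 * N = real (F * q)"
  shows "of_nat F * kloosterman_moment (2 * h) q
           = of_nat (((2 * h) choose h) * totient q) * of_real N ^ h"
proof -
  have q: "q > 1"
    using assms(1-3) prime_gt_1_nat one_less_power by blast
  define \<nu> where "\<nu> = (\<lambda>v. card {c \<in> units_mod q. [u\<^sub>0 * c\<^sup>2 = v] (mod int q)})"
  define K where "K = (\<lambda>u. Re (kloosterman_sum u 1 q))"
  have K: "kloosterman_sum u 1 q = of_real (K u)" for u
    using kloosterman_sum_real[OF q, of u 1] by (simp add: K_def complex_eq_iff)
  have moment: "kloosterman_moment m q = of_real (\<Sum>u\<in>{0..<int q}. K u ^ m)" for m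
    using q by (simp add: kloosterman_moment_alt K)
  have by_fibres: "complex_of_real (\<Sum>u\<in>{0..<int q}. real (\<nu> u) * K u ^ (2 * m))
                     = of_nat (((2 * m) choose m) * totient q) * of_real N ^ m"
    if "m \<le> h" for m
  proof -
    have "(\<Sum>u\<in>{0..<int q}. real (\<nu> u) * K u ^ (2 * m))
            = (\<Sum>u\<in>{0..<int q}. \<Sum>c\<in>{c \<in> units_mod q. u\<^sub>0 * c\<^sup>2 mod int q = u}.
                 K (u\<^sub>0 * c\<^sup>2) ^ (2 * m))"
    proof (rule sum.cong[OF refl])
      fix u assume u: "u \<in> {0..<int q}"
      have "(\<Sum>c\<in>{c \<in> units_mod q. u\<^sub>0 * c\<^sup>2 mod int q = u}. K (u\<^sub>0 * c\<^sup>2) ^ (2 * m))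
              = (\<Sum>c\<in>{c \<in> units_mod q. u\<^sub>0 * c\<^sup>2 mod int q = u}. K u ^ (2 * m))"
      proof (rule sum.cong[OF refl])
        fix c assume "c \<in> {c \<in> units_mod q. u\<^sub>0 * c\<^sup>2 mod int q = u}"
        hence "[u\<^sub>0 * c\<^sup>2 = u] (mod int q)" by (auto simp: cong_def)
        hence "K (u\<^sub>0 * c\<^sup>2) = K u"
          using q kloosterman_sum_cong[of q "u\<^sub>0 * c\<^sup>2" u 1] by (simp add: K_def)
        thus "K (u\<^sub>0 * c\<^sup>2) ^ (2 * m) = K u ^ (2 * m)" by simp
      qed
      moreover have "{c \<in> units_mod q. u\<^sub>0 * c\<^sup>2 mod int q = u}
                       = {c \<in> units_mod q. [u\<^sub>0 * c\<^sup>2 = u] (mod int q)}"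
        using u by (auto simp: cong_def)
      ultimately show "real (\<nu> u) * K u ^ (2 * m)
          = (\<Sum>c\<in>{c \<in> units_mod q. u\<^sub>0 * c\<^sup>2 mod int q = u}. K (u\<^sub>0 * c\<^sup>2) ^ (2 * m))"
        by (simp add: \<nu>_def)
    qed
    also have "\<dots> = (\<Sum>c\<in>units_mod q. K (u\<^sub>0 * c\<^sup>2) ^ (2 * m))"
      by (rule sum.group) (use q in auto)
    finally have "complex_of_real (\<Sum>u\<in>{0..<int q}. real (\<nu> u) * K u ^ (2 * m))
                    = (\<Sum>c\<in>units_mod q. kloosterman_sum (u\<^sub>0 * c\<^sup>2) 1 q ^ (2 * m))"
      by (simp add: K)
    also have "\<dots> = (\<Sum>c\<in>units_mod q. (A c + cnj (A c)) ^ (2 * m))"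
      by (intro sum.cong refl) (simp add: split units_mod_def)
    also have "\<dots> = of_nat (((2 * m) choose m) * totient q) * of_real N ^ m"
      by (rule sum_units_power_real_part[where h = h and \<omega> = \<omega> and p = p and r = r])
         (use assms that in auto)
    finally show ?thesis .
  qed
  have "complex_of_real (\<Sum>u\<in>{0..<int q}. real (\<nu> u) * K u ^ 2) = of_nat (2 * totient q) * of_real N"
    using by_fibres[of 1] \<open>h \<ge> 1\<close> by simp
  also have "\<dots> = of_real (real (totient q) * (2 * N))" by simp
  also have "\<dots> = of_nat F * of_nat (q * totient q)"
    unfolding NF by simp
  also have "\<dots> = of_nat F * kloosterman_moment 2 q"
    using kloosterman_second_moment[OF q] by simp
  also have "\<dots> = of_real (real F * (\<Sum>u\<in>{0..<int q}. K u ^ 2))"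
    by (simp add: moment)
  finally have "(\<Sum>u\<in>{0..<int q}. real (\<nu> u) * K u ^ 2) = real F * (\<Sum>u\<in>{0..<int q}. K u ^ 2)"
    by (simp only: of_real_eq_iff)
  \<comment> \<open>A vanishing sum of nonnegative terms: wherever the Kloosterman sum is nonzero, the fibre
    bound is attained.\<close>
  hence "(\<Sum>u\<in>{0..<int q}. (real F - real (\<nu> u)) * K u ^ 2) = 0"
    by (simp add: left_diff_distrib sum_subtractf sum_distrib_left)
  moreover have "(real F - real (\<nu> u)) * K u ^ 2 \<ge> 0" for u
    using fibre[of u] by (simp add: \<nu>_def)
  ultimately have "\<forall>u\<in>{0..<int q}. (real F - real (\<nu> u)) * K u ^ 2 = 0"
    by (subst sum_nonneg_eq_0_iff[symmetric]) auto
  hence "\<forall>u\<in>{0..<int q}. real F * K u ^ (2 * h) = real (\<nu> u) * K u ^ (2 * h)"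
    using \<open>h \<ge> 1\<close> by auto
  hence "real F * (\<Sum>u\<in>{0..<int q}. K u ^ (2 * h)) = (\<Sum>u\<in>{0..<int q}. real (\<nu> u) * K u ^ (2 * h))"
    unfolding sum_distrib_left by (intro sum.cong refl) blast
  moreover have "of_nat F * kloosterman_moment (2 * h) q
      = complex_of_real (real F * (\<Sum>u\<in>{0..<int q}. K u ^ (2 * h)))"
    by (simp add: moment)
  ultimately show ?thesis
    using by_fibres[of h] by simp
qed


section \<open>Stationary phase\<close>

definition phase :: "nat \<Rightarrow> int \<Rightarrow> int \<Rightarrow> int" where
  "phase q u y = u * y + modular_inverse (int q) y"

lemma phase_cong: "[x = y] (mod int q) \<Longrightarrow> [phase q u x = phase q u y] (mod int q)"
  unfolding phase_def by (intro cong_add cong_mult cong_refl modular_inverse_cong)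

lemma phase_minus:
  assumes "coprime y (int q)"
  shows "[phase q u (- y) = - phase q u y] (mod int q)"
proof -
  have "[u * (- y) + modular_inverse (int q) (- y) = u * (- y) + - modular_inverse (int q) y] (mod int q)"
    by (intro cong_add cong_refl modular_inverse_minus_cong assms)
  thus ?thesis by (simp add: phase_def)
qed

text \<open>
  The substitution \<open>x = c' * y\<close>, with \<open>c'\<close> inverse to \<open>c\<close>, moves the factor \<open>c\<^sup>2\<close> out of the
  phase as an overall factor \<open>c\<close>.
\<close>
lemma kloosterman_sum_square_multiple:
  assumes "q > 1" "coprime c (int q)"
  shows "kloosterman_sum (u * c\<^sup>2) 1 q = (\<Sum>y\<in>units_mod q. add_char q (c * phase q u y))"
proof -
  let ?inv = "modular_inverse (int q)"
  have ca: "[c * ?inv c = 1] (mod int q)"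
    by (rule cong_modular_inverse1[OF assms(2)])
  have "kloosterman_sum (u * c\<^sup>2) 1 q
          = (\<Sum>x\<in>units_mod q. add_char q (u * c\<^sup>2 * x + ?inv x))"
    by (simp add: kloosterman_sum_alt)
  also have "\<dots> = (\<Sum>y\<in>units_mod q. add_char q (u * c\<^sup>2 * (?inv c * y) + ?inv (?inv c * y)))"
    by (rule sum_units_mult[symmetric])
       (use assms in \<open>auto intro!: add_char_cong cong_add cong_mult modular_inverse_cong\<close>)
  also have "\<dots> = (\<Sum>y\<in>units_mod q. add_char q (c * phase q u y))"
  proof (intro sum.cong refl add_char_cong)
    fix y assume "y \<in> units_mod q"
    hence y: "[y * ?inv y = 1] (mod int q)"
      by (intro cong_modular_inverse1) (simp add: units_mod_def)
    have "[(c * ?inv c) * (y * ?inv y) = 1 * 1] (mod int q)"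
      by (intro cong_mult ca y)
    hence "[?inv (?inv c * y) = c * ?inv y] (mod int q)"
      by (intro cong_modular_inverseI) (simp add: mult_ac)
    moreover have "[(u * c * y) * (c * ?inv c) = (u * c * y) * 1] (mod int q)"
      by (intro cong_mult cong_refl ca)
    ultimately have "[(u * c * y) * (c * ?inv c) + ?inv (?inv c * y) = (u * c * y) * 1 + c * ?inv y]
            (mod int q)"
      by (intro cong_add)
    thus "[u * c\<^sup>2 * (?inv c * y) + ?inv (?inv c * y) = c * phase q u y] (mod int q)"
      by (simp add: phase_def algebra_simps power2_eq_square)
  qed (use assms in auto)
  finally show ?thesis .
qed

text \<open>
  Every substitution \<open>y \<mapsto> y * (1 + h * t)\<close> permutes \<open>Z\<close> and, to first order, adds
  \<open>h * t * d y\<close> to the phase. Averaging over \<open>t\<close> modulo \<open>M\<close> gives zero at each \<open>y\<close> at which the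
  logarithmic derivative \<open>d y\<close> is not divisible by \<open>M\<close>.
\<close>
lemma nonstationary_phase_sum:
  fixes h M c :: int
  assumes "q > 1" "coprime c (int q)" "h * M = int q" "h > 0"
    and Z: "Z \<subseteq> units_mod q"
    and closed: "\<And>y t. y \<in> Z \<Longrightarrow> (y * (1 + h * t)) mod int q \<in> Z"
    and cop: "\<And>t. coprime (1 + h * t) (int q)"
    and expand: "\<And>y t. y \<in> Z \<Longrightarrow> [phase q u (y * (1 + h * t)) = phase q u y + h * t * d y] (mod int q)"
    and nonstationary: "\<And>y. y \<in> Z \<Longrightarrow> \<not> M dvd d y"
  shows "(\<Sum>y\<in>Z. add_char q (c * phase q u y)) = 0"
proof -
  let ?S = "\<Sum>y\<in>Z. add_char q (c * phase q u y)"
  have "h * M > 0" unfolding assms(3) using assms(1) by simp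
  hence M: "M > 0" using \<open>h > 0\<close> by (simp add: zero_less_mult_iff)
  have translate: "?S = (\<Sum>y\<in>Z. add_char q (c * phase q u y) * add_char q (c * h * d y * t))" for t
  proof -
    have "?S = (\<Sum>y\<in>Z. add_char q (c * phase q u (y * (1 + h * t))))"
    proof (rule sum_reindex_mod[where M = "int q", symmetric])
      show "Z \<subseteq> {0..<int q}" using Z assms(1) by (auto simp: units_mod_eq)
      show "[x = y] (mod int q)" if "[x * (1 + h * t) = y * (1 + h * t)] (mod int q)" for x y
        using that cop[of t] by (simp add: cong_mult_rcancel)
    qed (use closed assms(1) in \<open>auto intro!: add_char_cong cong_mult phase_cong\<close>)
    also have "\<dots> = (\<Sum>y\<in>Z. add_char q (c * (phase q u y + h * t * d y)))"
      by (intro sum.cong refl add_char_cong cong_mult cong_refl expand) (use assms(1) in auto)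
    also have "\<dots> = (\<Sum>y\<in>Z. add_char q (c * phase q u y) * add_char q (c * h * d y * t))"
      unfolding add_char_add[symmetric] by (simp add: algebra_simps)
    finally show ?thesis .
  qed
  have "of_int M * ?S = (\<Sum>t\<in>{0..<M}. ?S)"
    using M by simp
  also have "\<dots> = (\<Sum>t\<in>{0..<M}. \<Sum>y\<in>Z. add_char q (c * phase q u y) * add_char q (c * h * d y * t))"
    by (rule sum.cong[OF refl]) (rule translate)
  also have "\<dots> = (\<Sum>y\<in>Z. \<Sum>t\<in>{0..<M}. add_char q (c * phase q u y) * add_char q (c * h * d y * t))"
    by (rule sum.swap)
  also have "\<dots> = (\<Sum>y\<in>Z. 0)"
  proof (rule sum.cong[OF refl])
    fix y assume "y \<in> Z"
    have "coprime M c"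
      using assms(2) unfolding assms(3)[symmetric] by (simp add: coprime_commute)
    hence "\<not> M dvd c * d y"
      using nonstationary[OF \<open>y \<in> Z\<close>] by (simp add: coprime_dvd_mult_right_iff)
    hence "\<not> h * M dvd h * (c * d y)"
      using \<open>h > 0\<close> by simp
    hence "\<not> int q dvd c * h * d y"
      unfolding assms(3) by (simp add: mult_ac)
    moreover have "int q dvd c * h * d y * M"
      unfolding assms(3)[symmetric] by simp
    ultimately have "(\<Sum>t\<in>{0..<M}. add_char q (c * h * d y * t)) = 0"
      using add_char_orthogonality[of q M "c * h * d y"] assms(1) M by simp
    thus "(\<Sum>t\<in>{0..<M}. add_char q (c * phase q u y) * add_char q (c * h * d y * t)) = 0"
      by (simp add: sum_distrib_left[symmetric])
  qed
  finally show ?thesis using M by simp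
qed

lemma sum_units_congruent_1:
  fixes D L :: int and g :: "int \<Rightarrow> complex"
  assumes "q > 1" "D * L = int q" "D > 1" and cop: "\<And>t. coprime (1 + D * t) (int q)"
  shows "(\<Sum>y\<in>{y \<in> units_mod q. [y = 1] (mod D)}. g y) = (\<Sum>t\<in>{0..<L}. g (1 + D * t))"
proof (rule sum.reindex_bij_witness[of _ "\<lambda>t. 1 + D * t" "\<lambda>y. (y - 1) div D"])
  fix y assume y: "y \<in> {y \<in> units_mod q. [y = 1] (mod D)}"
  hence "D dvd y - 1" by (simp add: cong_iff_dvd_diff)
  then obtain t where t: "y - 1 = D * t" by (elim dvdE)
  have "y \<in> units_mod q" using y by simp
  hence y': "0 < y" "y < D * L"
    using units_mod_eq[OF assms(1)] unfolding assms(2) by (simp add: units_mod_def, fastforce)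
  have "0 \<le> D * t" using t y' by linarith
  hence "0 \<le> t" using \<open>D > 1\<close> by (simp add: zero_le_mult_iff)
  moreover have "D * t < D * L" using t y' by linarith
  hence "t < L" using \<open>D > 1\<close> by simp
  moreover have "(y - 1) div D = t" using t \<open>D > 1\<close> by simp
  ultimately show "1 + D * ((y - 1) div D) = y" "(y - 1) div D \<in> {0..<L}"
    using t by auto
  show "g (1 + D * ((y - 1) div D)) = g y"
    using \<open>(y - 1) div D = t\<close> t by (metis add.commute diff_add_cancel)
next
  fix t assume t: "t \<in> {0..<L}"
  show "(1 + D * t - 1) div D = t" using \<open>D > 1\<close> by simp
  have "D * t \<le> D * (L - 1)" using t \<open>D > 1\<close> by (intro mult_left_mono) auto
  hence "1 + D * t < int q"
    unfolding assms(2)[symmetric] using \<open>D > 1\<close> by (simp add: algebra_simps)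
  moreover have "0 \<le> D * t" using t \<open>D > 1\<close> by simp
  ultimately show "1 + D * t \<in> {y \<in> units_mod q. [y = 1] (mod D)}"
    using cop[of t] by (auto simp: units_mod_def cong_iff_dvd_diff)
qed

text \<open>
  Units that are neither \<open>1\<close> nor \<open>-1\<close> modulo \<open>D\<close> are not stationary and cancel out. The
  classes of \<open>1\<close> and \<open>-1\<close> are exchanged by \<open>y \<mapsto> - y\<close>, which negates the phase, so their
  contributions are complex conjugates; they are disjoint because \<open>D > 2\<close>. The function \<open>\<psi>\<close> is
  whatever normal form the phase takes at \<open>1 + D * t\<close>.
\<close>
lemma kloosterman_sum_localized:
  fixes h M D L c :: int
  assumes "q > 1" "coprime c (int q)" "h * M = int q" "h > 0" "D dvd h" "D * L = int q" "D > 2"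
    and cop: "\<And>t. coprime (1 + D * t) (int q)"
    and expand: "\<And>y t. coprime y (int q) \<Longrightarrow>
                   [phase q u (y * (1 + h * t)) = phase q u y + h * t * d y] (mod int q)"
    and stationary: "\<And>y. coprime y (int q) \<Longrightarrow> M dvd d y \<Longrightarrow> [y = 1] (mod D) \<or> [y = -1] (mod D)"
    and val: "\<And>t. [phase q u (1 + D * t) = \<psi> t] (mod int q)"
  shows "kloosterman_sum (u * c\<^sup>2) 1 q = (\<Sum>t\<in>{0..<L}. add_char q (c * \<psi> t))
                                     + cnj (\<Sum>t\<in>{0..<L}. add_char q (c * \<psi> t))"
proof -
  let ?g = "\<lambda>y. add_char q (c * phase q u y)"
  let ?Y = "\<lambda>a. {y \<in> units_mod q. [y = a] (mod D)}"
  define Z where "Z = {y \<in> units_mod q. \<not> [y = 1] (mod D) \<and> \<not> [y = -1] (mod D)}"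
  have Dq: "D dvd int q" by (metis assms(6) dvd_triv_left)
  have g_cong: "?g x = ?g y" if "[x = y] (mod int q)" for x y
    using that assms(1) by (intro add_char_cong cong_mult cong_refl phase_cong) auto
  have "\<not> [1 = -1] (mod D)"
    using \<open>D > 2\<close> by (auto simp: cong_iff_dvd_diff dest!: zdvd_imp_le)
  hence disjoint: "?Y 1 \<inter> ?Y (-1) = {}"
    using cong_sym cong_trans by blast
  have "(\<Sum>y\<in>Z. ?g y) = 0"
  proof (rule nonstationary_phase_sum[where h = h and M = M and d = d])
    show coph: "coprime (1 + h * t) (int q)" for t
      using cop \<open>D dvd h\<close> by (metis dvdE mult.assoc)
    fix y t assume y: "y \<in> Z"
    hence "coprime y (int q)" by (simp add: Z_def units_mod_def)
    hence "(y * (1 + h * t)) mod int q \<in> units_mod q"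
      using coph assms(1) by (intro mod_in_units_mod) auto
    moreover have "[(y * (1 + h * t)) mod int q = y] (mod D)"
    proof -
      have "[y * (1 + h * t) = y] (mod D)"
        using \<open>D dvd h\<close> by (simp add: cong_iff_dvd_diff algebra_simps)
      thus ?thesis using Dq by (simp add: cong_def mod_mod_cancel)
    qed
    ultimately show "(y * (1 + h * t)) mod int q \<in> Z"
      using y unfolding Z_def by (auto intro: cong_trans cong_sym)
  next
    show "Z \<subseteq> units_mod q" by (auto simp: Z_def)
    fix y t assume y: "y \<in> Z"
    hence cop_y: "coprime y (int q)" by (simp add: Z_def units_mod_def)
    show "[phase q u (y * (1 + h * t)) = phase q u y + h * t * d y] (mod int q)"
      by (rule expand[OF cop_y])
    show "\<not> M dvd d y"
      using stationary[OF cop_y] y by (auto simp: Z_def)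
  qed (use assms in auto)
  moreover have "(\<Sum>y\<in>units_mod q. ?g y) = (\<Sum>y\<in>(?Y 1 \<union> ?Y (-1)) \<union> Z. ?g y)"
    by (rule sum.cong) (auto simp: Z_def)
  moreover have "\<dots> = (\<Sum>y\<in>?Y 1 \<union> ?Y (-1). ?g y) + (\<Sum>y\<in>Z. ?g y)"
    by (rule sum.union_disjoint) (auto simp: Z_def)
  moreover have "(\<Sum>y\<in>?Y 1 \<union> ?Y (-1). ?g y) = (\<Sum>y\<in>?Y 1. ?g y) + (\<Sum>y\<in>?Y (-1). ?g y)"
    by (rule sum.union_disjoint[OF _ _ disjoint]) auto
  ultimately have "(\<Sum>y\<in>units_mod q. ?g y) = (\<Sum>y\<in>?Y 1. ?g y) + (\<Sum>y\<in>?Y (-1). ?g y)"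
    by simp
  moreover have "(\<Sum>y\<in>?Y (-1). ?g y) = cnj (\<Sum>y\<in>?Y 1. ?g y)"
  proof -
    have "(\<Sum>y\<in>?Y (-1). ?g y) = (\<Sum>y\<in>units_mod q. if [y = -1] (mod D) then ?g y else 0)"
      by (simp add: sum.inter_filter)
    also have "\<dots> = (\<Sum>y\<in>units_mod q. if [-1 * y = -1] (mod D) then ?g (-1 * y) else 0)"
    proof (rule sum_units_mult[symmetric])
      fix x y :: int assume xy: "[x = y] (mod int q)"
      hence "[x = y] (mod D)" using Dq cong_dvd_modulus by blast
      hence "[x = -1] (mod D) \<longleftrightarrow> [y = -1] (mod D)"
        by (meson cong_sym cong_trans)
      thus "(if [x = -1] (mod D) then ?g x else 0) = (if [y = -1] (mod D) then ?g y else 0)"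
        using g_cong[OF xy] by simp
    qed (use assms(1) in auto)
    also have "\<dots> = (\<Sum>y\<in>units_mod q. if [y = 1] (mod D) then cnj (?g y) else 0)"
    proof (rule sum.cong[OF refl])
      fix y assume "y \<in> units_mod q"
      hence "[c * phase q u (- y) = c * - phase q u y] (mod int q)"
        by (intro cong_mult cong_refl phase_minus) (simp add: units_mod_def)
      hence "?g (- y) = cnj (?g y)"
        using assms(1) add_char_cong[of q] by (simp add: cnj_add_char)
      moreover have "[- y = - 1] (mod D) \<longleftrightarrow> [y = 1] (mod D)"
        by (simp add: cong_minus_minus_iff)
      ultimately show "(if [-1 * y = -1] (mod D) then ?g (-1 * y) else 0)
                         = (if [y = 1] (mod D) then cnj (?g y) else 0)"
        by simp
    qed
    also have "\<dots> = cnj (\<Sum>y\<in>?Y 1. ?g y)"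
      by (simp add: sum.inter_filter) (rule sum.cong, auto)
    finally show ?thesis .
  qed
  moreover have "(\<Sum>y\<in>?Y 1. ?g y) = (\<Sum>t\<in>{0..<L}. ?g (1 + D * t))"
    by (rule sum_units_congruent_1) (use assms in auto)
  moreover have "\<dots> = (\<Sum>t\<in>{0..<L}. add_char q (c * \<psi> t))"
    by (intro sum.cong refl add_char_cong cong_mult cong_refl val) (use assms(1) in auto)
  ultimately show ?thesis
    using kloosterman_sum_square_multiple[OF assms(1,2)] by simp
qed


section \<open>Square roots of unity modulo prime powers\<close>

text \<open>
  The factors \<open>z - 1\<close> and \<open>z + 1\<close> differ by \<open>2\<close>, so an odd prime divides at most one of them.
\<close>
lemma square_cong_1_odd_prime_power:
  assumes "prime p" "odd p" "int p ^ k dvd z\<^sup>2 - 1"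
  shows "[z = 1] (mod int p ^ k) \<or> [z = -1] (mod int p ^ k)"
proof -
  have p: "prime (int p)" using assms(1) by simp
  have dvd: "int p ^ k dvd (z - 1) * (z + 1)"
    using assms(3) by (simp add: power2_eq_square algebra_simps)
  have "\<not> (int p dvd z - 1 \<and> int p dvd z + 1)"
  proof
    assume "int p dvd z - 1 \<and> int p dvd z + 1"
    hence "int p dvd (z + 1) - (z - 1)" using dvd_diff by blast
    hence "int p dvd int 2" by simp
    hence "p dvd 2" by (simp only: int_dvd_int_iff)
    hence "p \<le> 2" by (simp add: dvd_imp_le)
    thus False using assms(1,2) prime_ge_2_nat[of p] by (cases "p = 2") auto
  qed
  then consider "coprime (int p ^ k) (z + 1)" | "coprime (int p ^ k) (z - 1)"
    using prime_imp_coprime[OF p] by (meson coprime_power_left_iff)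
  thus ?thesis
  proof cases
    case 1
    hence "int p ^ k dvd z - 1" using dvd by (simp add: coprime_dvd_mult_left_iff)
    thus ?thesis by (simp add: cong_iff_dvd_diff)
  next
    case 2
    hence "int p ^ k dvd z + 1" using dvd by (simp add: coprime_dvd_mult_right_iff)
    thus ?thesis by (simp add: cong_iff_dvd_diff)
  qed
qed

text \<open>
  One power of \<open>2\<close> is lost because \<open>z - 1\<close> and \<open>z + 1\<close> are both even; with \<open>z = 2 * a + 1\<close>
  their product is \<open>4 * a * (a + 1)\<close>, where \<open>a\<close> and \<open>a + 1\<close> are coprime.
\<close>
lemma square_cong_1_power_2:
  fixes z :: int
  assumes "2 ^ Suc k dvd z\<^sup>2 - 1" "k > 0"
  shows "[z = 1] (mod 2 ^ k) \<or> [z = -1] (mod 2 ^ k)"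
proof -
  obtain m where k: "k = Suc m" using \<open>k > 0\<close> by (cases k) auto
  have "even (z\<^sup>2 - 1)" using assms(1) by (metis dvd_trans dvd_power zero_less_Suc)
  hence "odd z" by simp
  then obtain a where a: "z = 2 * a + 1" by (elim oddE)
  have "z\<^sup>2 - 1 = 4 * (a * (a + 1))"
    by (simp add: a power2_eq_square algebra_simps)
  hence "(4 :: int) * 2 ^ m dvd 4 * (a * (a + 1))"
    using assms(1) by (simp add: k mult.assoc)
  hence dvd: "2 ^ m dvd a * (a + 1)"
    by (simp only: dvd_mult_cancel_left) simp
  show ?thesis
  proof (cases "even a")
    case True
    hence "coprime (2 ^ m) (a + 1)" by simp
    hence "2 ^ m dvd a" using dvd by (simp add: coprime_dvd_mult_left_iff)
    hence "2 * 2 ^ m dvd 2 * a" by simp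
    thus ?thesis by (simp add: cong_iff_dvd_diff a k)
  next
    case False
    hence "coprime (2 ^ m) a" by simp
    hence "2 ^ m dvd a + 1" using dvd by (simp add: coprime_dvd_mult_right_iff)
    hence "2 * 2 ^ m dvd 2 * (a + 1)" by (rule mult_dvd_mono[OF dvd_refl])
    moreover have "z + 1 = 2 * (a + 1)" by (simp add: a)
    ultimately have "2 ^ k dvd z + 1" by (simp only: k power_Suc)
    thus ?thesis by (simp add: cong_iff_dvd_diff)
  qed
qed

text \<open>
  Dividing by one point of the fibre maps the fibre injectively into the square roots of \<open>1\<close>.
\<close>
lemma card_square_fibre_le:
  assumes "coprime u (int q)" "finite T"
    and roots: "\<And>z. [z\<^sup>2 = 1] (mod int q) \<Longrightarrow> \<exists>e\<in>T. [z = e] (mod int q)"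
    and "q > 1"
  shows "card {c \<in> units_mod q. [u * c\<^sup>2 = v] (mod int q)} \<le> card T"
proof (cases "{c \<in> units_mod q. [u * c\<^sup>2 = v] (mod int q)} = {}")
  case False
  then obtain d where d: "d \<in> units_mod q" "[u * d\<^sup>2 = v] (mod int q)" by auto
  have "coprime d (int q)" using d by (simp add: units_mod_def)
  define d' where "d' = modular_inverse (int q) d"
  have dd': "[d * d' = 1] (mod int q)"
    unfolding d'_def by (rule cong_modular_inverse1) fact
  have "{c \<in> units_mod q. [u * c\<^sup>2 = v] (mod int q)} \<subseteq> (\<lambda>e. (e * d) mod int q) ` T"
  proof
    fix c assume "c \<in> {c \<in> units_mod q. [u * c\<^sup>2 = v] (mod int q)}"
    hence c: "c \<in> units_mod q" "[u * c\<^sup>2 = u * d\<^sup>2] (mod int q)"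
      using d(2) by (auto intro: cong_trans cong_sym)
    hence "[c\<^sup>2 = d\<^sup>2] (mod int q)"
      using assms(1) by (simp add: cong_mult_lcancel)
    hence "[c\<^sup>2 * d'\<^sup>2 = d\<^sup>2 * d'\<^sup>2] (mod int q)"
      by (intro cong_mult cong_refl)
    also have "d\<^sup>2 * d'\<^sup>2 = (d * d')\<^sup>2" by (simp add: power_mult_distrib)
    also have "[(d * d')\<^sup>2 = 1\<^sup>2] (mod int q)" by (intro cong_pow dd')
    finally have "[(c * d')\<^sup>2 = 1] (mod int q)" by (simp add: power_mult_distrib)
    then obtain e where e: "e \<in> T" "[c * d' = e] (mod int q)" using roots by blast
    have "[e * d = c * d' * d] (mod int q)"
      by (intro cong_mult cong_refl cong_sym[OF e(2)])
    also have "c * d' * d = c * (d * d')" by simp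
    also have "[c * (d * d') = c * 1] (mod int q)" by (intro cong_mult cong_refl dd')
    finally have "(e * d) mod int q = c"
      using c(1) \<open>q > 1\<close> by (simp add: units_mod_eq cong_def)
    thus "c \<in> (\<lambda>e. (e * d) mod int q) ` T" using e(1) by blast
  qed
  hence "card {c \<in> units_mod q. [u * c\<^sup>2 = v] (mod int q)} \<le> card ((\<lambda>e. (e * d) mod int q) ` T)"
    using assms(2) by (intro card_mono) auto
  also have "\<dots> \<le> card T" using assms(2) by (rule card_image_le)
  finally show ?thesis .
next
  case True
  thus ?thesis by (metis card.empty zero_le)
qed

lemma card_square_fibre_odd_prime_power:
  assumes "prime p" "odd p" "r > 0" "q = p ^ r" "coprime u (int q)"
  shows "card {c \<in> units_mod q. [u * c\<^sup>2 = v] (mod int q)} \<le> 2"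
proof -
  have "q > 1" using assms(1,3,4) prime_gt_1_nat one_less_power by blast
  have "card {c \<in> units_mod q. [u * c\<^sup>2 = v] (mod int q)} \<le> card {1, -1 :: int}"
  proof (rule card_square_fibre_le)
    fix z assume "[z\<^sup>2 = 1] (mod int q)"
    hence "int p ^ r dvd z\<^sup>2 - 1" by (simp add: cong_iff_dvd_diff assms(4))
    from square_cong_1_odd_prime_power[OF assms(1,2) this]
    show "\<exists>e\<in>{1, -1}. [z = e] (mod int q)" by (simp add: assms(4))
  qed (use assms \<open>q > 1\<close> in auto)
  thus ?thesis by simp
qed

text \<open>
  The square roots of \<open>1\<close> are \<open>1\<close> and \<open>-1\<close> modulo \<open>2 ^ (r - 1)\<close>, each with two lifts modulo
  \<open>2 ^ r\<close>.
\<close>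
lemma card_square_fibre_power_2:
  assumes "r > 1" "q = 2 ^ r" "coprime u (int q)"
  shows "card {c \<in> units_mod q. [u * c\<^sup>2 = v] (mod int q)} \<le> 4"
proof -
  obtain k where k: "r = Suc k" "k > 0" using assms(1) by (cases r) auto
  have q: "int q = 2 * 2 ^ k" by (simp add: assms(2) k)
  let ?T = "{1, -1, 1 + 2 ^ k, -1 + 2 ^ k} :: int set"
  have "card {c \<in> units_mod q. [u * c\<^sup>2 = v] (mod int q)} \<le> card ?T"
  proof (rule card_square_fibre_le)
    fix z assume "[z\<^sup>2 = 1] (mod int q)"
    hence "2 ^ Suc k dvd z\<^sup>2 - 1" by (simp add: cong_iff_dvd_diff q)
    from square_cong_1_power_2[OF this \<open>k > 0\<close>]
    obtain e where e: "e \<in> {1, -1}" "[z = e] (mod 2 ^ k)" by auto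
    then obtain a where "z - e = 2 ^ k * a"
      unfolding cong_iff_dvd_diff by (auto elim: dvdE)
    hence a: "z = e + 2 ^ k * a" by simp
    have "[z = e] (mod int q) \<or> [z = e + 2 ^ k] (mod int q)"
    proof (cases "even a")
      case True
      then obtain b where "a = 2 * b" by (elim evenE)
      hence "z - e = int q * b" by (simp add: a q)
      hence "[z = e] (mod int q)" unfolding cong_iff_dvd_diff by simp
      thus ?thesis ..
    next
      case False
      then obtain b where "a = 2 * b + 1" by (elim oddE)
      hence "z - (e + 2 ^ k) = int q * b" by (simp add: a q algebra_simps)
      hence "[z = e + 2 ^ k] (mod int q)" unfolding cong_iff_dvd_diff by simp
      thus ?thesis ..
    qed
    thus "\<exists>e\<in>?T. [z = e] (mod int q)" using e(1) by auto
  next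
    show "q > 1" using assms(1,2) one_less_power[of "2::nat" r] by simp
  qed (use assms in auto)
  also have "card ?T \<le> 4"
    by (simp add: card_insert_if)
  finally show ?thesis .
qed

section \<open>Local expansion of the phase\<close>

text \<open>
  The geometric series for \<open>1 / (1 + x)\<close>, cut off after the square:
  \<open>(1 + x) * (1 - x + x\<^sup>2) = 1 + x ^ 3\<close>.
\<close>
lemma modular_inverse_times_one_plus:
  fixes q :: nat and x y :: int
  assumes "coprime y (int q)" "int q dvd x ^ 3"
  shows "[modular_inverse (int q) (y * (1 + x)) = modular_inverse (int q) y * (1 - x + x\<^sup>2)] (mod int q)"
proof (rule cong_modular_inverseI)
  let ?i = "modular_inverse (int q) y"
  have "[(y * ?i) * (1 + x ^ 3) = 1 * (1 + 0)] (mod int q)"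
    by (intro cong_mult cong_modular_inverse1 assms(1) cong_add cong_refl)
       (use assms(2) in \<open>simp add: cong_0_iff\<close>)
  also have "(y * ?i) * (1 + x ^ 3) = y * (1 + x) * (?i * (1 - x + x\<^sup>2))"
    by (simp add: algebra_simps power2_eq_square power3_eq_cube)
  finally show "[y * (1 + x) * (?i * (1 - x + x\<^sup>2)) = 1] (mod int q)" by simp
qed

lemma phase_expansion:
  assumes "coprime y (int q)" "int q dvd h ^ 3"
  shows "[phase q u (y * (1 + h * t))
            = phase q u y + h * t * (u * y - modular_inverse (int q) y)
                + h\<^sup>2 * (t\<^sup>2 * modular_inverse (int q) y)] (mod int q)"
proof -
  let ?i = "modular_inverse (int q) y"
  have "int q dvd (h * t) ^ 3" using assms(2) by (simp add: power_mult_distrib)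
  hence "[u * (y * (1 + h * t)) + modular_inverse (int q) (y * (1 + h * t))
           = u * (y * (1 + h * t)) + ?i * (1 - h * t + (h * t)\<^sup>2)] (mod int q)"
    by (intro cong_add cong_refl modular_inverse_times_one_plus assms(1))
  thus ?thesis
    by (simp add: phase_def algebra_simps power2_eq_square)
qed

lemma phase_expansion_linear:
  assumes "coprime y (int q)" "int q dvd h\<^sup>2"
  shows "[phase q u (y * (1 + h * t))
            = phase q u y + h * t * (u * y - modular_inverse (int q) y)] (mod int q)"
proof -
  have "int q dvd h ^ 3" using assms(2) by (simp add: power3_eq_cube power2_eq_square)
  moreover have "[phase q u y + h * t * (u * y - modular_inverse (int q) y)
                + h\<^sup>2 * (t\<^sup>2 * modular_inverse (int q) y)
              = phase q u y + h * t * (u * y - modular_inverse (int q) y)] (mod int q)"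
    using assms(2) by (simp add: cong_iff_dvd_diff)
  ultimately show ?thesis using phase_expansion[OF assms(1)] cong_trans by blast
qed

lemma phase_near_1:
  assumes "int q dvd D ^ 3"
  shows "[phase q u (1 + D * t) = u * (1 + D * t) + 1 - D * t + D\<^sup>2 * t\<^sup>2] (mod int q)"
proof -
  have "int q dvd (D * t) ^ 3" using assms by (simp add: power_mult_distrib)
  hence "[modular_inverse (int q) (1 * (1 + D * t))
            = modular_inverse (int q) 1 * (1 - D * t + (D * t)\<^sup>2)] (mod int q)"
    by (intro modular_inverse_times_one_plus) auto
  also have "[modular_inverse (int q) 1 * (1 - D * t + (D * t)\<^sup>2)
                = 1 * (1 - D * t + (D * t)\<^sup>2)] (mod int q)"
    by (rule cong_mult[OF cong_modular_inverseI cong_refl]) simp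
  finally have "[modular_inverse (int q) (1 + D * t) = 1 * (1 - D * t + (D * t)\<^sup>2)] (mod int q)"
    by simp
  hence "[u * (1 + D * t) + modular_inverse (int q) (1 + D * t)
            = u * (1 + D * t) + 1 * (1 - D * t + (D * t)\<^sup>2)] (mod int q)"
    by (intro cong_add cong_refl)
  thus ?thesis by (simp add: phase_def power_mult_distrib algebra_simps)
qed

text \<open>
  The logarithmic derivative of \<open>y + 1 / y\<close> is \<open>y - 1 / y\<close>, so stationary points are approximate
  square roots of \<open>1\<close>.
\<close>
lemma stationary_point_square:
  assumes "coprime y (int q)" "M dvd int q" "M dvd y - modular_inverse (int q) y"
  shows "M dvd y\<^sup>2 - 1"
proof -
  have "int q dvd y * modular_inverse (int q) y - 1"
    using cong_modular_inverse1[OF assms(1)] by (simp add: cong_iff_dvd_diff)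
  hence "M dvd y * modular_inverse (int q) y - 1" using assms(2) dvd_trans by blast
  moreover have "M dvd y * (y - modular_inverse (int q) y)" using assms(3) by simp
  ultimately have "M dvd y * (y - modular_inverse (int q) y) + (y * modular_inverse (int q) y - 1)"
    by (rule dvd_add[rotated])
  also have "y * (y - modular_inverse (int q) y) + (y * modular_inverse (int q) y - 1) = y\<^sup>2 - 1"
    by (simp add: algebra_simps power2_eq_square)
  finally show ?thesis .
qed


section \<open>Odd primes\<close>

lemma card_multiples_lessThan:
  fixes D E :: int
  assumes "D > 0" "E > 0"
  shows "card {d \<in> {0..<D * E}. E dvd d} = nat D"
proof -
  have "{d \<in> {0..<D * E}. E dvd d} = (\<lambda>k. k * E) ` {0..<D}"
  proof (rule Set.set_eqI)
    fix d
    show "d \<in> {d \<in> {0..<D * E}. E dvd d} \<longleftrightarrow> d \<in> (\<lambda>k. k * E) ` {0..<D}"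
      using assms by (auto elim!: dvdE simp: mult.commute[of E] zero_le_mult_iff)
  qed
  moreover have "inj_on (\<lambda>k. k * E) {0..<D}"
    using assms(2) by (auto simp: inj_on_def)
  ultimately show ?thesis by (simp add: card_image)
qed

text \<open>
  Since \<open>D\<^sup>2 * E = q\<close>, this is a Gauss sum modulo \<open>E\<close> repeated \<open>D\<close> times, up to the factor
  \<open>add_char q (c * 2)\<close>. In the double sum for its square modulus put \<open>a = d + b\<close>; the sum over
  \<open>b\<close> is geometric and kills all \<open>d\<close> except the \<open>D\<close> multiples of \<open>E\<close>, each of which contributes
  \<open>D * E\<close>.
\<close>
lemma norm_gauss_sum:
  fixes D E c :: int
  assumes q: "int q = D\<^sup>2 * E" and "D > 0" "E > 0" and cop: "coprime (2 * c) (int q)"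
  shows "(cmod (\<Sum>t\<in>{0..<D * E}. add_char q (c * (2 + D\<^sup>2 * t\<^sup>2))))\<^sup>2 = real q"
proof -
  let ?L = "D * E"
  let ?g = "\<lambda>t. add_char q (c * (D\<^sup>2 * t\<^sup>2))"
  let ?G = "\<Sum>t\<in>{0..<?L}. ?g t"
  have "int q > 0" unfolding q using assms(2,3) by simp
  hence q0: "q > 0" by simp
  have L0: "?L > 0" using assms(2,3) by simp
  have per: "?g x = ?g y" if xy: "[x = y] (mod ?L)" for x y
  proof (rule add_char_cong[OF q0])
    have "?L dvd x - y" using xy by (simp add: cong_iff_dvd_diff)
    hence "D\<^sup>2 * E dvd D * (x - y)" by (simp add: power2_eq_square mult.assoc)
    hence "D\<^sup>2 * E dvd (D * (x - y)) * (c * D * (x + y))" by (rule dvd_mult2)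
    also have "(D * (x - y)) * (c * D * (x + y)) = c * (D\<^sup>2 * x\<^sup>2) - c * (D\<^sup>2 * y\<^sup>2)"
      by (simp add: power2_eq_square algebra_simps)
    finally show "[c * (D\<^sup>2 * x\<^sup>2) = c * (D\<^sup>2 * y\<^sup>2)] (mod int q)"
      by (simp add: q cong_iff_dvd_diff)
  qed
  have inner: "(\<Sum>b\<in>{0..<?L}. add_char q (2 * c * D\<^sup>2 * d * b)) = (if E dvd d then of_int ?L else 0)" for d
  proof -
    have "coprime E (2 * c)"
      using cop unfolding q by (simp add: coprime_commute)
    hence "E dvd d \<longleftrightarrow> E dvd 2 * c * d" by (rule coprime_dvd_mult_right_iff[symmetric])
    also have "\<dots> \<longleftrightarrow> D\<^sup>2 * E dvd D\<^sup>2 * (2 * c * d)" using assms(2) by simp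
    also have "D\<^sup>2 * (2 * c * d) = 2 * c * D\<^sup>2 * d" by simp
    finally have "int q dvd 2 * c * D\<^sup>2 * d \<longleftrightarrow> E dvd d" unfolding q by simp
    moreover have "int q dvd 2 * c * D\<^sup>2 * d * ?L" unfolding q by simp
    ultimately show ?thesis
      using add_char_orthogonality[OF q0, of ?L "2 * c * D\<^sup>2 * d"] L0 by simp
  qed
  have "?G * cnj ?G = (\<Sum>b\<in>{0..<?L}. \<Sum>a\<in>{0..<?L}. ?g a * cnj (?g b))"
    by (simp only: cnj_sum sum_product) (rule sum.swap)
  also have "\<dots> = (\<Sum>b\<in>{0..<?L}. \<Sum>d\<in>{0..<?L}. ?g (d + b) * cnj (?g b))"
    by (intro sum.cong refl sum_shift_mod[symmetric]) (use per in auto)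
  also have "\<dots> = (\<Sum>b\<in>{0..<?L}. \<Sum>d\<in>{0..<?L}. ?g d * add_char q (2 * c * D\<^sup>2 * d * b))"
    unfolding cnj_add_char add_char_add[symmetric]
    by (simp add: power2_eq_square algebra_simps)
  also have "\<dots> = (\<Sum>d\<in>{0..<?L}. \<Sum>b\<in>{0..<?L}. ?g d * add_char q (2 * c * D\<^sup>2 * d * b))"
    by (rule sum.swap)
  also have "\<dots> = (\<Sum>d\<in>{0..<?L}. if E dvd d then of_int ?L else 0)"
  proof (rule sum.cong[OF refl])
    fix d
    have "?g d = 1" if "E dvd d"
    proof -
      have "D\<^sup>2 * E dvd c * (D\<^sup>2 * d\<^sup>2)"
        using that by (simp add: power2_eq_square)
      thus ?thesis using q0 by (simp add: add_char_eq_1_iff q)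
    qed
    thus "(\<Sum>b\<in>{0..<?L}. ?g d * add_char q (2 * c * D\<^sup>2 * d * b)) = (if E dvd d then of_int ?L else 0)"
      by (simp add: sum_distrib_left[symmetric] inner)
  qed
  also have "\<dots> = of_nat (card {d \<in> {0..<?L}. E dvd d}) * of_int ?L"
    by (simp add: sum.inter_filter[symmetric])
  also have "\<dots> = of_int (D * ?L)"
    using assms(2,3) unfolding card_multiples_lessThan[OF assms(2,3)] by simp
  also have "D * ?L = int q" by (simp add: q power2_eq_square)
  finally have "?G * cnj ?G = of_nat q" by simp
  hence "complex_of_real ((cmod ?G)\<^sup>2) = complex_of_real (real q)"
    by (simp only: complex_norm_square of_real_of_nat_eq)
  hence "(cmod ?G)\<^sup>2 = real q" by (simp only: of_real_eq_iff)
  moreover have "(\<Sum>t\<in>{0..<?L}. add_char q (c * (2 + D\<^sup>2 * t\<^sup>2))) = add_char q (c * 2) * ?G"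
    by (simp add: distrib_left add_char_add sum_distrib_left)
  ultimately show ?thesis by (simp add: norm_mult)
qed

text \<open>
  Take \<open>D = p ^ (r div 2)\<close> and \<open>E = q / D\<^sup>2\<close>, which is \<open>1\<close> or \<open>p\<close>, so that both parities of \<open>r\<close>
  are treated together. Near \<open>y = 1\<close> the phase is \<open>2 + D\<^sup>2 * t\<^sup>2\<close>. Because \<open>q\<close> divides \<open>p * D\<^sup>2\<close>,
  the quadratic term does not see the translation \<open>c \<mapsto> c + p\<close>, and \<open>A (c + p)\<close> differs from
  \<open>A c\<close> by the factor \<open>add_char q (2 * p)\<close> alone.
\<close>
lemma kloosterman_moment_odd_prime_power:
  assumes "prime p" "odd p" "r \<ge> 2" "h \<ge> 1" "h < p ^ (r - 1)" and q: "q = p ^ r"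
  shows "2 * kloosterman_moment (2 * h) q
           = of_nat (((2 * h) choose h) * totient q) * of_nat q ^ h"
proof -
  define s where "s = r div 2"
  have s: "s \<ge> 1" "r \<le> 2 * s + 1" "2 * s \<le> r" using assms(3) by (auto simp: s_def)
  define D where "D = int p ^ s"
  define E where "E = int p ^ (r - 2 * s)"
  have p: "p > 2" using assms(1,2) prime_ge_2_nat[of p] by (cases "p = 2") auto
  have q1: "q > 1" unfolding q using p assms(3) by (intro one_less_power) auto
  have pD: "int p dvd D" using s(1) by (simp add: D_def dvd_power)
  have "int p \<le> D" using s(1) p by (simp add: D_def self_le_power)
  hence D: "D > 2" using p by simp
  have E: "E > 0" using p by (simp add: E_def)
  have qD: "int q = D\<^sup>2 * E"
    using s(3) by (simp add: q D_def E_def power_mult[symmetric] power_add[symmetric] mult.commute)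
  have E_dvd: "E dvd int p"
    using s by (cases "r = 2 * s") (auto simp: E_def le_Suc_eq)
  have q_dvd: "int q dvd int p * D\<^sup>2"
    using E_dvd by (simp add: qD mult.commute mult_dvd_mono)
  have q_dvd3: "int q dvd D ^ 3"
    using E_dvd pD by (simp add: qD power3_eq_cube power2_eq_square dvd_trans[OF E_dvd pD])
  have unit_iff: "coprime x (int q) \<longleftrightarrow> \<not> int p dvd x" for x
    unfolding q using assms(1,3) by (intro coprime_prime_power_iff) auto
  have p_not_dvd_2: "\<not> int p dvd 2" using p zdvd_imp_le[of "int p" 2] by auto
  define A where "A = (\<lambda>c. \<Sum>t\<in>{0..<D * E}. add_char q (c * (2 + D\<^sup>2 * t\<^sup>2)))"
  have "of_nat 2 * kloosterman_moment (2 * h) q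
           = of_nat (((2 * h) choose h) * totient q) * of_real (real q) ^ h"
  proof (rule kloosterman_moment_of_covariant_splitting
             [where A = A and \<omega> = "add_char q (4 * int p)" and u\<^sub>0 = 1 and p = p and r = r])
    fix c assume c: "coprime c (int q)"
    show "kloosterman_sum (1 * c\<^sup>2) 1 q = A c + cnj (A c)"
      unfolding A_def
    proof (rule kloosterman_sum_localized
             [where h = "D * E" and M = D and d = "\<lambda>y. y - modular_inverse (int q) y"])
      show "coprime (1 + D * t) (int q)" for t
      proof -
        have "int p dvd D * t" using pD by simp
        hence "\<not> int p dvd 1 + D * t"
          using p by (simp add: dvd_add_left_iff)
        thus ?thesis by (simp add: unit_iff)
      qed
      fix y t assume y: "coprime y (int q)"
      \<comment> \<open>This divisibility makes the expansion of the phase linear in \<open>t\<close>.\<close>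
      have "int q dvd (D * E)\<^sup>2" by (simp add: qD power2_eq_square)
      from phase_expansion_linear[OF y this, of 1 t]
      show "[phase q 1 (y * (1 + D * E * t))
               = phase q 1 y + D * E * t * (y - modular_inverse (int q) y)] (mod int q)"
        by simp
    next
      fix y assume y: "coprime y (int q)" "D dvd y - modular_inverse (int q) y"
      have "D dvd y\<^sup>2 - 1"
        by (rule stationary_point_square[OF y(1) _ y(2)]) (simp add: qD power2_eq_square)
      thus "[y = 1] (mod D) \<or> [y = -1] (mod D)"
        unfolding D_def by (rule square_cong_1_odd_prime_power[OF assms(1,2)])
    next
      show "[phase q 1 (1 + D * t) = 2 + D\<^sup>2 * t\<^sup>2] (mod int q)" for t
        using phase_near_1[OF q_dvd3, of 1 t] by simp
    qed (use q1 c D E qD in \<open>auto simp: power2_eq_square\<close>)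
    show "(cmod (A c))\<^sup>2 = real q"
      unfolding A_def
    proof (rule norm_gauss_sum[OF qD])
      have "\<not> int p dvd 2 * c"
        using c assms(1) p_not_dvd_2 by (simp add: unit_iff prime_dvd_mult_iff)
      thus "coprime (2 * c) (int q)" by (simp add: unit_iff)
    qed (use D E in auto)
    have "A (c + int p) = add_char q (2 * int p) * A c"
      unfolding A_def sum_distrib_left add_char_add[symmetric]
    proof (intro sum.cong refl add_char_cong)
      fix t
      have "int q dvd int p * D\<^sup>2 * t\<^sup>2" using q_dvd by simp
      also have "int p * D\<^sup>2 * t\<^sup>2
          = (c + int p) * (2 + D\<^sup>2 * t\<^sup>2) - (2 * int p + c * (2 + D\<^sup>2 * t\<^sup>2))"
        by (simp add: algebra_simps)
      finally show "[(c + int p) * (2 + D\<^sup>2 * t\<^sup>2) = 2 * int p + c * (2 + D\<^sup>2 * t\<^sup>2)] (mod int q)"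
        by (simp add: cong_iff_dvd_diff)
    qed (use q1 in auto)
    thus "A (c + int p) ^ 2 = add_char q (4 * int p) * A c ^ 2"
      by (simp add: power_mult_distrib add_char_power)
  next
    fix c d assume "[c = d] (mod int q)"
    thus "A c = A d"
      unfolding A_def by (intro sum.cong refl add_char_cong cong_mult cong_refl) (use q1 in auto)
  next
    fix j assume j: "0 < j" "j \<le> h"
    show "add_char q (4 * int p) ^ j \<noteq> 1"
    proof
      assume "add_char q (4 * int p) ^ j = 1"
      hence "int q dvd int p * int (4 * j)"
        using q1 by (simp add: add_char_power add_char_eq_1_iff mult_ac)
      moreover have "int q = int p * int (p ^ (r - 1))"
        using assms(3) by (simp add: q power_Suc[symmetric] del: power_Suc)
      ultimately have "int (p ^ (r - 1)) dvd int (4 * j)" using p by simp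
      hence "p ^ (r - 1) dvd 4 * j" by (simp only: int_dvd_int_iff)
      moreover have "coprime (p ^ (r - 1)) (2 ^ 2)"
        using assms(2) by (intro coprime_power_left_iff[THEN iffD2] coprime_power_right_iff[THEN iffD2])
                          (simp add: coprime_right_2_iff_odd)
      ultimately have "p ^ (r - 1) dvd j"
        by (simp add: coprime_dvd_mult_right_iff)
      hence "p ^ (r - 1) \<le> j" using j(1) by (rule dvd_imp_le)
      thus False using j(2) assms(5) by simp
    qed
  next
    show "card {c \<in> units_mod q. [1 * c\<^sup>2 = v] (mod int q)} \<le> 2" for v
      by (rule card_square_fibre_odd_prime_power[OF assms(1,2) _ q]) (use assms(3) in auto)
  qed (use assms in auto)
  thus ?thesis by simp
qed

section \<open>Powers of two\<close>

lemma add_char_power_neq_1: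
  assumes q: "q = 2 ^ r" "r \<ge> 3" and "odd w" "0 < j" "j < 2 ^ (r - 3)"
  shows "add_char q (8 * w) ^ j \<noteq> 1"
proof
  assume *: "add_char q (8 * w) ^ j = 1"
  obtain k where r: "r = k + 3" using q(2) by (metis le_add_diff_inverse2)
  have "int q = 8 * 2 ^ k" by (simp add: q(1) r power_add)
  hence "8 * 2 ^ k dvd 8 * (w * int j)"
    using * q(1) by (simp add: add_char_power add_char_eq_1_iff mult_ac)
  hence "2 ^ k dvd w * int j" by (simp only: dvd_mult_cancel_left) simp
  moreover have "coprime (2 ^ k) w" using \<open>odd w\<close> by simp
  ultimately have "int (2 ^ k) dvd int j" by (simp add: coprime_dvd_mult_right_iff)
  hence "2 ^ k dvd j" by (simp only: int_dvd_int_iff)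
  hence "2 ^ k \<le> j" using assms(4) by (rule dvd_imp_le)
  thus False using assms(5) by (simp add: r)
qed

lemma coprime_power_2_iff:
  assumes "q = 2 ^ r" "r > 0"
  shows "coprime x (int q) \<longleftrightarrow> odd (x :: int)"
  using assms by simp

text \<open>
  Here \<open>q = 2 * D\<^sup>2\<close> with \<open>D = 2 ^ s\<close>. With \<open>u\<^sub>0 = 1\<close> the quadratic term in \<open>D * t\<close> would
  interfere with stationarity. Modulo \<open>2\<close>, however, squaring is the identity, so that
  \<open>D\<^sup>2 * t\<^sup>2\<close> agrees with the linear term \<open>D\<^sup>2 * t\<close> modulo \<open>q\<close>, and the choice \<open>u\<^sub>0 = 1 + D\<close>
  absorbs it: the phase is then constant, equal to \<open>2 + D\<close>, on the class of \<open>1\<close> modulo \<open>D\<close>.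
\<close>
lemma kloosterman_moment_power_2_odd_exponent:
  assumes "s \<ge> 2" "h \<ge> 1" "h < 2 ^ (2 * s + 1 - 3)" and q: "q = 2 ^ (2 * s + 1)"
  shows "4 * kloosterman_moment (2 * h) q
           = of_nat (((2 * h) choose h) * totient q) * of_nat (2 * q) ^ h"
proof -
  define D :: int where "D = 2 ^ s"
  obtain D' where D': "D = 4 * D'" "D' > 0"
  proof
    show "D = 4 * 2 ^ (s - 2)"
      unfolding D_def using assms(1) by (metis le_add_diff_inverse power_add power2_eq_square num_double numeral_times_numeral)
  qed simp
  have q1: "q > 1" unfolding q by (rule one_less_power) auto
  have qD: "int q = 2 * D\<^sup>2" by (simp add: q D_def power_mult mult.commute)
  have q_dvd3: "int q dvd D ^ 3"
    unfolding qD by (simp add: power3_eq_cube power2_eq_square D'(1))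
  have unit_iff: "coprime x (int q) \<longleftrightarrow> odd x" for x
    by (rule coprime_power_2_iff[OF q]) simp
  define A where "A = (\<lambda>c. \<Sum>t\<in>{0..<2 * D}. add_char q (c * (2 + D)))"
  have A_eq: "A c = of_int (2 * D) * add_char q (c * (2 + D))" for c
    using D' by (simp add: A_def)
  have "of_nat 4 * kloosterman_moment (2 * h) q
           = of_nat (((2 * h) choose h) * totient q) * of_real (real (2 * q)) ^ h"
  proof (rule kloosterman_moment_of_covariant_splitting
             [where A = A and \<omega> = "add_char q (8 * (1 + 2 * D'))" and u\<^sub>0 = "1 + D" and p = 2
                and r = "2 * s + 1"])
    fix c assume c: "coprime c (int q)"
    show "kloosterman_sum ((1 + D) * c\<^sup>2) 1 q = A c + cnj (A c)"
      unfolding A_def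
    proof (rule kloosterman_sum_localized
             [where h = D and M = "2 * D" and d = "\<lambda>y. (1 + D) * y - modular_inverse (int q) y + D"])
      show "coprime (1 + D * t) (int q)" for t
        by (simp add: unit_iff D'(1))
      fix y t assume y: "coprime y (int q)"
      let ?i = "modular_inverse (int q) y"
      have "coprime ?i (int q)" using y by (rule coprime_modular_inverse)
      hence "odd ?i" by (simp add: unit_iff)
      hence "even (t\<^sup>2 * ?i - t)" by simp
      then obtain k where "t\<^sup>2 * ?i - t = 2 * k" by (elim evenE)
      hence "D\<^sup>2 * (t\<^sup>2 * ?i) = D * t * D + int q * k"
        unfolding qD by (simp add: power2_eq_square algebra_simps)
      hence "phase q (1 + D) y + D * t * ((1 + D) * y - ?i) + D\<^sup>2 * (t\<^sup>2 * ?i)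
               - (phase q (1 + D) y + D * t * ((1 + D) * y - ?i + D)) = int q * k"
        by (simp add: algebra_simps)
      hence "[phase q (1 + D) y + D * t * ((1 + D) * y - ?i) + D\<^sup>2 * (t\<^sup>2 * ?i)
               = phase q (1 + D) y + D * t * ((1 + D) * y - ?i + D)] (mod int q)"
        unfolding cong_iff_dvd_diff by simp
      with phase_expansion[OF y q_dvd3, of "1 + D" t]
      show "[phase q (1 + D) (y * (1 + D * t))
               = phase q (1 + D) y + D * t * ((1 + D) * y - ?i + D)] (mod int q)"
        by (rule cong_trans)
    next
      fix y assume y: "coprime y (int q)" "2 * D dvd (1 + D) * y - modular_inverse (int q) y + D"
      let ?i = "modular_inverse (int q) y"
      have "even (y + 1)" using y(1) by (simp add: unit_iff)
      hence "2 * D dvd (y + 1) * D" by (rule mult_dvd_mono) simp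
      hence "2 * D dvd ((1 + D) * y - ?i + D) - (y + 1) * D"
        using y(2) by (rule dvd_diff[rotated])
      also have "((1 + D) * y - ?i + D) - (y + 1) * D = y - ?i"
        by (simp add: algebra_simps)
      finally have "2 * D dvd y\<^sup>2 - 1"
        by (rule stationary_point_square[OF y(1), rotated]) (simp add: qD power2_eq_square)
      hence "2 ^ Suc s dvd y\<^sup>2 - 1" by (simp add: D_def)
      thus "[y = 1] (mod D) \<or> [y = -1] (mod D)"
        unfolding D_def by (rule square_cong_1_power_2) (use assms(1) in simp)
    next
      fix t :: int
      have "even (t * (t + 1))" by simp
      then obtain k where "t * (t + 1) = 2 * k" by (elim evenE)
      hence "D\<^sup>2 * (t * (t + 1)) = int q * k" unfolding qD by simp
      hence "((1 + D) * (1 + D * t) + 1 - D * t + D\<^sup>2 * t\<^sup>2) - (2 + D) = int q * k"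
        by (simp add: algebra_simps power2_eq_square)
      hence "[(1 + D) * (1 + D * t) + 1 - D * t + D\<^sup>2 * t\<^sup>2 = 2 + D] (mod int q)"
        unfolding cong_iff_dvd_diff by simp
      with phase_near_1[OF q_dvd3, of "1 + D" t]
      show "[phase q (1 + D) (1 + D * t) = 2 + D] (mod int q)"
        by (rule cong_trans)
    qed (use q1 c D' qD in \<open>auto simp: power2_eq_square\<close>)
    show "(cmod (A c))\<^sup>2 = real (2 * q)"
    proof -
      have "(cmod (A c))\<^sup>2 = real_of_int ((2 * D)\<^sup>2)"
        by (simp add: A_eq norm_mult power_mult_distrib)
      also have "(2 * D)\<^sup>2 = 2 * int q" by (simp add: qD power2_eq_square)
      finally show ?thesis by simp
    qed
    have "A (c + int 2) = add_char q (2 * (2 + D)) * A c"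
      by (simp add: A_eq distrib_right add_char_add)
    hence "A (c + int 2) ^ 2 = add_char q (2 * (2 + D) * 2) * A c ^ 2"
      by (simp add: power_mult_distrib add_char_power)
    also have "2 * (2 + D) * 2 = 8 * (1 + 2 * D')" by (simp add: D'(1))
    finally show "A (c + int 2) ^ 2 = add_char q (8 * (1 + 2 * D')) * A c ^ 2" .
  next
    fix c d assume "[c = d] (mod int q)"
    thus "A c = A d"
      unfolding A_def by (intro sum.cong refl add_char_cong cong_mult cong_refl) (use q1 in auto)
  next
    fix j assume "0 < j" "j \<le> h"
    thus "add_char q (8 * (1 + 2 * D')) ^ j \<noteq> 1"
      by (intro add_char_power_neq_1[OF q]) (use assms in auto)
  next
    show "card {c \<in> units_mod q. [(1 + D) * c\<^sup>2 = v] (mod int q)} \<le> 4" for v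
      by (rule card_square_fibre_power_2[OF _ q]) (use assms(1) in \<open>auto simp: unit_iff D'(1)\<close>)
  qed (use assms in auto)
  thus ?thesis by simp
qed

lemma sum_by_parity:
  fixes a b :: complex
  shows "(\<Sum>t\<in>{0..<2 * int m}. if even t then a else b) = of_nat m * (a + b)"
proof (induction m)
  case (Suc m)
  have "{0..<2 * int (Suc m)} = insert (2 * int m + 1) (insert (2 * int m) {0..<2 * int m})"
    by auto
  thus ?case using Suc by (simp add: algebra_simps)
qed simp

text \<open>
  Here \<open>q = 4 * D\<^sup>2\<close> with \<open>D = 2 ^ s\<close>, and the quadratic phase \<open>D\<^sup>2 * t\<^sup>2\<close> depends only on the
  parity of \<open>t\<close>. So \<open>A c\<close> is a phase factor times \<open>2 * D * (1 + g c)\<close> with \<open>g c\<close> equal to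
  \<open>\<i> ^ c\<close>. The identity \<open>(1 + g c)\<^sup>2 = 2 * g c\<close> makes \<open>A c ^ 2\<close> equal to \<open>2 * q\<close> times a single
  character value, from which both the modulus and the covariance are read off.
\<close>
lemma kloosterman_moment_power_2_even_exponent:
  assumes "s \<ge> 2" "h \<ge> 1" "h < 2 ^ (2 * s + 2 - 3)" and q: "q = 2 ^ (2 * s + 2)"
  shows "4 * kloosterman_moment (2 * h) q
           = of_nat (((2 * h) choose h) * totient q) * of_nat (2 * q) ^ h"
proof -
  define D :: int where "D = 2 ^ s"
  obtain D' where D': "D = 4 * D'" "D' > 0"
  proof
    show "D = 4 * 2 ^ (s - 2)"
      unfolding D_def using assms(1) by (metis le_add_diff_inverse power_add power2_eq_square num_double numeral_times_numeral)
  qed simp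
  have q1: "q > 1" unfolding q by (rule one_less_power) auto
  have qD: "int q = 4 * D\<^sup>2" by (simp add: q D_def power_mult power_add mult.commute)
  have q_dvd3: "int q dvd D ^ 3"
    unfolding qD by (simp add: power3_eq_cube power2_eq_square D'(1))
  have unit_iff: "coprime x (int q) \<longleftrightarrow> odd x" for x
    by (rule coprime_power_2_iff[OF q]) simp
  define g where "g = (\<lambda>c. add_char q (c * D\<^sup>2))"
  have g_square: "(g c)\<^sup>2 = -1" if "odd c" for c
  proof -
    have "\<not> 4 * D\<^sup>2 dvd 2 * (c * D\<^sup>2)"
    proof
      assume "4 * D\<^sup>2 dvd 2 * (c * D\<^sup>2)"
      hence "D\<^sup>2 * 4 dvd D\<^sup>2 * (2 * c)" by (simp add: mult_ac)
      hence "4 dvd 2 * c" using D' by (simp only: dvd_mult_cancel_left) simp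
      thus False using that by presburger
    qed
    hence "(g c)\<^sup>2 \<noteq> 1"
      using q1 qD by (simp add: g_def add_char_power add_char_eq_1_iff mult.commute)
    moreover have "((g c)\<^sup>2)\<^sup>2 = 1"
      using q1 qD by (simp add: g_def add_char_power add_char_eq_1_iff mult_ac)
    ultimately show ?thesis
      using power2_eq_1_iff[of "(g c)\<^sup>2"] by blast
  qed
  define A where "A = (\<lambda>c. \<Sum>t\<in>{0..<4 * D}. add_char q (c * (2 + D\<^sup>2 * t\<^sup>2)))"
  have A_eq: "A c = of_int (2 * D) * (add_char q (c * 2) * (1 + g c))" for c
  proof -
    have "A c = (\<Sum>t\<in>{0..<2 * int (nat (2 * D))}.
                   if even t then add_char q (c * 2) else add_char q (c * 2 + c * D\<^sup>2))"
      unfolding A_def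
    proof (rule sum.cong)
      fix t :: int
      have "int q dvd c * D\<^sup>2 * t\<^sup>2" if "even t"
        using that by (auto elim!: evenE simp: qD power2_eq_square mult_ac)
      moreover have "int q dvd c * D\<^sup>2 * (t\<^sup>2 - 1)" if "odd t"
        using that by (auto elim!: oddE simp: qD power2_eq_square algebra_simps)
      ultimately show "add_char q (c * (2 + D\<^sup>2 * t\<^sup>2))
            = (if even t then add_char q (c * 2) else add_char q (c * 2 + c * D\<^sup>2))"
        using q1 by (auto intro!: add_char_cong simp: cong_iff_dvd_diff algebra_simps)
    qed (use D' in auto)
    also have "\<dots> = of_int (2 * D) * (add_char q (c * 2) + add_char q (c * 2 + c * D\<^sup>2))"
      unfolding sum_by_parity using D' by simp
    finally show ?thesis by (simp add: add_char_add g_def distrib_left)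
  qed
  have A_square: "A c ^ 2 = of_nat (2 * q) * add_char q (c * (4 + D\<^sup>2))" if "odd c" for c
  proof -
    have "(1 + g c)\<^sup>2 = 2 * g c"
      using g_square[OF that] by (simp add: power2_sum)
    hence "A c ^ 2 = of_int ((2 * D)\<^sup>2) * (add_char q (c * 2 * 2) * (2 * g c))"
      by (simp add: A_eq power_mult_distrib add_char_power)
    also have "(2 * D)\<^sup>2 = int q" by (simp add: qD power_mult_distrib)
    finally show ?thesis by (simp add: g_def distrib_left add_char_add mult.assoc)
  qed
  have "of_nat 4 * kloosterman_moment (2 * h) q
           = of_nat (((2 * h) choose h) * totient q) * of_real (real (2 * q)) ^ h"
  proof (rule kloosterman_moment_of_covariant_splitting
             [where A = A and \<omega> = "add_char q (8 * (1 + 4 * D'\<^sup>2))" and u\<^sub>0 = 1 and p = 2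
                and r = "2 * s + 2"])
    fix c assume c: "coprime c (int q)"
    hence "odd c" by (simp add: unit_iff)
    show "kloosterman_sum (1 * c\<^sup>2) 1 q = A c + cnj (A c)"
      unfolding A_def
    proof (rule kloosterman_sum_localized
             [where h = "2 * D" and M = "2 * D" and D = D
                and d = "\<lambda>y. y - modular_inverse (int q) y"])
      show "coprime (1 + D * t) (int q)" for t
        by (simp add: unit_iff D'(1))
      fix y t assume y: "coprime y (int q)"
      have "int q dvd (2 * D)\<^sup>2" by (simp add: qD power2_eq_square)
      from phase_expansion_linear[OF y this, of 1 t]
      show "[phase q 1 (y * (1 + 2 * D * t))
               = phase q 1 y + 2 * D * t * (y - modular_inverse (int q) y)] (mod int q)"
        by simp
    next
      fix y assume y: "coprime y (int q)" "2 * D dvd y - modular_inverse (int q) y"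
      have "2 * D dvd y\<^sup>2 - 1"
        by (rule stationary_point_square[OF y(1) _ y(2)]) (simp add: qD power2_eq_square)
      hence "2 ^ Suc s dvd y\<^sup>2 - 1" by (simp add: D_def)
      thus "[y = 1] (mod D) \<or> [y = -1] (mod D)"
        unfolding D_def by (rule square_cong_1_power_2) (use assms(1) in simp)
    next
      show "[phase q 1 (1 + D * t) = 2 + D\<^sup>2 * t\<^sup>2] (mod int q)" for t
        using phase_near_1[OF q_dvd3, of 1 t] by simp
    qed (use q1 c D' qD in \<open>auto simp: power2_eq_square\<close>)
    have "(cmod (A c))\<^sup>2 = cmod (A c ^ 2)" by (simp add: norm_power)
    also have "\<dots> = real (2 * q)"
      unfolding A_square[OF \<open>odd c\<close>] norm_mult norm_of_nat norm_add_char by simp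
    finally show "(cmod (A c))\<^sup>2 = real (2 * q)" .
    have "odd (c + int 2)" using \<open>odd c\<close> by simp
    hence "A (c + int 2) ^ 2 = of_nat (2 * q) * add_char q (2 * (4 + D\<^sup>2) + c * (4 + D\<^sup>2))"
      by (simp add: A_square algebra_simps)
    also have "\<dots> = add_char q (2 * (4 + D\<^sup>2)) * A c ^ 2"
      by (simp add: A_square[OF \<open>odd c\<close>] add_char_add)
    also have "2 * (4 + D\<^sup>2) = 8 * (1 + 4 * D'\<^sup>2)" by (simp add: D'(1) power_mult_distrib)
    finally show "A (c + int 2) ^ 2 = add_char q (8 * (1 + 4 * D'\<^sup>2)) * A c ^ 2" .
  next
    fix c d assume "[c = d] (mod int q)"
    thus "A c = A d"
      unfolding A_def by (intro sum.cong refl add_char_cong cong_mult cong_refl) (use q1 in auto)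
  next
    fix j assume "0 < j" "j \<le> h"
    thus "add_char q (8 * (1 + 4 * D'\<^sup>2)) ^ j \<noteq> 1"
      by (intro add_char_power_neq_1[OF q]) (use assms in auto)
  next
    show "card {c \<in> units_mod q. [1 * c\<^sup>2 = v] (mod int q)} \<le> 4" for v
      by (rule card_square_fibre_power_2[OF _ q]) (use assms(1) in auto)
  qed (use assms in auto)
  thus ?thesis by simp
qed

section \<open>The even moments\<close>

lemma central_binomial_eq_double:
  assumes "h \<ge> 1"
  shows "(2 * h) choose h = 2 * ((2 * h - 1) choose (h - 1))"
proof -
  obtain k where h: "h = Suc k" using assms by (cases h) auto
  have "(2 * h) choose h = (Suc (2 * k) choose k) + (Suc (2 * k) choose Suc k)"
    by (simp add: h)
  moreover have "Suc (2 * k) choose Suc k = Suc (2 * k) choose k"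
    using binomial_symmetric[of k "Suc (2 * k)"] by (simp add: Suc_diff_le)
  ultimately show ?thesis by (simp add: h)
qed

lemma kloosterman_moment_power_2:
  assumes "r \<ge> 4" "h \<ge> 1" "h < 2 ^ (r - 3)" and q: "q = 2 ^ r"
  shows "4 * kloosterman_moment (2 * h) q
           = of_nat (((2 * h) choose h) * totient q) * of_nat (2 * q) ^ h"
proof (cases "r = 4")
  case True
  \<comment> \<open>The classes of \<open>1\<close> and \<open>-1\<close> modulo \<open>D = 2\<close> would coincide; only the second moment is left.\<close>
  hence "h = 1" using assms(2,3) by simp
  moreover have "kloosterman_moment 2 q = of_nat (q * totient q)"
    by (rule kloosterman_second_moment) (simp add: q True)
  ultimately show ?thesis by simp
next
  case False
  show ?thesis
  proof (cases "even r")
    case True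
    then obtain t where t: "r = 2 * t" by (elim evenE)
    define s where "s = t - 1"
    have "r = 2 * s + 2" "s \<ge> 2" using t assms(1) False by (auto simp: s_def)
    thus ?thesis using assms by (intro kloosterman_moment_power_2_even_exponent) auto
  next
    case False
    then obtain s where "r = 2 * s + 1" by (elim oddE)
    moreover from this have "s \<ge> 2" using assms(1) by simp
    ultimately show ?thesis using assms by (intro kloosterman_moment_power_2_odd_exponent) auto
  qed
qed

theorem theorem4:
  fixes n p r :: nat
  assumes "n \<ge> 2" and "even n" and "prime p" and "r > 0"
  shows "(odd p \<and> real r > log (real p) (real n / 2) + 1 \<longrightarrow>
            kloosterman_moment n (p ^ r) =
              of_nat ((n - 1) choose (n div 2 - 1)) * ((of_nat p - 1) / of_nat p)
                * of_nat p ^ ((n div 2 + 1) * r))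
       \<and> (p = 2 \<and> real r > log 2 (real n) + 2 \<longrightarrow>
            kloosterman_moment n (2 ^ r) =
              of_nat ((n - 1) choose (n div 2 - 1)) * 2 powi (int (n div 2) - 2)
                * 2 ^ ((n div 2 + 1) * r))"
proof -
  obtain h where n: "n = 2 * h" using assms(2) by (elim evenE)
  have h: "h \<ge> 1" using assms(1) n by simp
  have p: "p > 1" using assms(3) by (rule prime_gt_1_nat)
  let ?B = "(2 * h - 1) choose (h - 1)"
  have odd_case: "kloosterman_moment (2 * h) (p ^ r)
      = of_nat ?B * ((of_nat p - 1) / of_nat p) * of_nat p ^ ((h + 1) * r)"
    if "odd p" and r: "real r > log (real p) (real h) + 1"
  proof -
    have "log (real p) (real h) \<ge> 0" using p h by simp
    hence r2: "r \<ge> 2" using r by simp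
    have "log (real p) (real h) < real (r - 1)" using r r2 by (simp add: of_nat_diff)
    hence "real h < real p powr real (r - 1)" using p h by (simp add: log_less_iff)
    hence "real h < real (p ^ (r - 1))" using p by (simp add: powr_realpow)
    hence "h < p ^ (r - 1)" by (simp only: of_nat_less_iff)
    from kloosterman_moment_odd_prime_power[OF assms(3) that(1) r2 h this refl]
    have "kloosterman_moment (2 * h) (p ^ r)
            = of_nat ?B * of_nat (totient (p ^ r)) * of_nat (p ^ r) ^ h"
      by (simp add: central_binomial_eq_double[OF h])
    moreover have "of_nat (totient (p ^ r)) = (complex_of_nat p - 1) / of_nat p * of_nat p ^ r"
    proof -
      obtain k where k: "r = Suc k" using assms(4) by (cases r) auto
      have "totient (p ^ r) = p ^ k * (p - 1)"
        unfolding k by (rule totient_prime_power_Suc[OF assms(3)])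
      thus ?thesis using p by (simp add: k of_nat_diff)
    qed
    moreover have "complex_of_nat p ^ ((h + 1) * r) = of_nat p ^ r * of_nat (p ^ r) ^ h"
      by (simp add: power_add power_mult[symmetric] mult.commute)
    ultimately show ?thesis by simp
  qed
  have even_case: "kloosterman_moment (2 * h) (2 ^ r)
      = of_nat ?B * 2 powi (int h - 2) * 2 ^ ((h + 1) * r)"
    if r: "real r > log 2 (real (2 * h)) + 2"
  proof -
    have log: "log 2 (real (2 * h)) = 1 + log 2 (real h)" using h by (simp add: log_mult)
    have "log 2 (real h) \<ge> 0" using h by simp
    hence r4: "r \<ge> 4" using r log by simp
    have "log 2 (real h) < real (r - 3)" using r r4 log by (simp add: of_nat_diff)
    hence "real h < 2 powr real (r - 3)" using h by (simp add: log_less_iff)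
    hence "real h < real (2 ^ (r - 3))" by (simp add: powr_realpow)
    hence "h < 2 ^ (r - 3)" by (simp only: of_nat_less_iff)
    from kloosterman_moment_power_2[OF r4 h this refl]
    have moment: "2 * kloosterman_moment (2 * h) (2 ^ r)
            = of_nat ?B * of_nat (totient (2 ^ r)) * of_nat (2 * 2 ^ r) ^ h"
      by (simp add: central_binomial_eq_double[OF h])
    have phi: "2 * complex_of_nat (totient (2 ^ r)) = 2 ^ r"
    proof -
      obtain k where k: "r = Suc k" using assms(4) by (cases r) auto
      have "totient (2 ^ r) = 2 ^ k" using totient_prime_power_Suc[of 2 k] by (simp add: k)
      thus ?thesis by (simp add: k)
    qed
    have pow: "complex_of_nat (2 * 2 ^ r) ^ h = 2 ^ h * 2 ^ (h * r)"
      by (simp add: power_mult_distrib power_mult[symmetric] mult.commute)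
    have "4 * kloosterman_moment (2 * h) (2 ^ r) = 2 * (2 * kloosterman_moment (2 * h) (2 ^ r))"
      by simp
    also have "\<dots> = of_nat ?B * (2 * of_nat (totient (2 ^ r))) * of_nat (2 * 2 ^ r) ^ h"
      unfolding moment by (simp only: mult_ac)
    finally have "kloosterman_moment (2 * h) (2 ^ r)
                    = of_nat ?B * (2 ^ h / 4) * (2 ^ r * 2 ^ (h * r))"
      unfolding phi pow by (simp add: mult_ac)
    also have "(2 ^ h / 4 :: complex) = 2 powi (int h - 2)"
      by (simp add: power_int_diff)
    finally show ?thesis by (simp add: power_add)
  qed
  show ?thesis using odd_case even_case n by simp
qed

end
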